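(* Let $T_n$ be an Eulerian tournament on $n$ vertices (so $n$ is odd). Then $$\mathrm{arb}(T_n) \geq \frac{1}{n^2}\left(\left(\frac{n+1}{2}\right)^{n} + \left(\frac{n-1}{2}\right)^{n}\right),$$ with equality if and only if $T_n\cong SW_n$, where $SW_n$ is the swirl tournament on $n$ vertices.
   Context: A tournament on $n$ vertices is an orientation of the complete graph $K_n$; it is Eulerian if every vertex has equal in-degree and out-degree. An arborescence of a directed graph $D$ rooted at a vertex $v$ is a spanning tree of $D$ in which every vertex different from $v$ has out-degree $1$ and $v$ has out-degree $0$ (every edge is oriented towards the root). $\mathrm{arb}(D,v)$ is the number of arborescences of $D$ rooted at $v$. For an Eulerian digraph $D$ this number does not depend on $v$ and is denoted $\mathrm{arb}(D)$. For odd $n=2d+1$, the swirl tournament $SW_n$ has vertex set $[n]=\{1,\dots,n\}$ and directed edges $\{(i,\,i+k \bmod n) : i\in[n],\ 1\le k\le d\}$ (residues modulo $n$ are represented in $[n]$). *)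

theory Defs
  imports Complex_Main "Graph_Theory.Graph_Theory"
begin

definition tournament :: "'a pair_pre_digraph \<Rightarrow> bool" where
  "tournament T \<longleftrightarrow> pair_digraph T \<and>
     (\<forall>u \<in> pverts T. \<forall>v \<in> pverts T. u \<noteq> v \<longrightarrow>
        ((u, v) \<in> parcs T \<longleftrightarrow> (v, u) \<notin> parcs T))"

definition eulerian :: "'a pair_pre_digraph \<Rightarrow> bool" where
  "eulerian D \<longleftrightarrow> (\<forall>v \<in> pverts D. in_degree D v = out_degree D v)"

text \<open>
  The library's predicate \<open>tree\<close> excludes only directed cycles, so a transitive triangle
  satisfies it. Here cycles are taken in the underlying undirected graph, represented
  by \<^const>\<open>mk_symmetric\<close>. There every edge, traversed back and forth, is a library
  cycle of length 2, so the genuine cycles are those of length at least 3. The condition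
  \<^const>\<open>asym\<close> rules out loops and pairs of opposite arcs, which \<^const>\<open>mk_symmetric\<close>
  would not detect.
\<close>

definition oriented_tree :: "'a pair_pre_digraph \<Rightarrow> bool" where
  "oriented_tree H \<longleftrightarrow> Digraph_Component.connected H \<and> asym (parcs H) \<and>
     (\<nexists>p. pre_digraph.cycle (mk_symmetric H) p \<and> 3 \<le> length p)"

definition arborescence ::
  "'a pair_pre_digraph \<Rightarrow> 'a \<Rightarrow> 'a pair_pre_digraph \<Rightarrow> bool" where
  "arborescence D r H \<longleftrightarrow> r \<in> pverts D \<and> spanning H D \<and> oriented_tree H \<and>
     out_degree H r = 0 \<and> (\<forall>v \<in> pverts D - {r}. out_degree H v = 1)"

definition arb_at :: "'a pair_pre_digraph \<Rightarrow> 'a \<Rightarrow> nat" where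
  "arb_at D r = card {H. arborescence D r H}"

text \<open>
  Meaningful only if the number of arborescences is the same for all roots,
  as it is for a nonempty finite Eulerian digraph.
\<close>

definition arb :: "'a pair_pre_digraph \<Rightarrow> nat" where
  "arb D = (THE k. \<forall>r \<in> pverts D. arb_at D r = k)"

text \<open>Intended for odd \<open>n\<close> only.\<close>

definition swirl :: "nat \<Rightarrow> nat pair_pre_digraph" where
  "swirl n = \<lparr> pverts = {1..n},
     parcs = {(i, j) | i j k. i \<in> {1..n} \<and> j \<in> {1..n} \<and> k \<in> {1..(n - 1) div 2} \<and>
                j mod n = (i + k) mod n} \<rparr>"

end

theory Submission
  imports Defs "Jordan_Normal_Form.Determinant" "HOL-Number_Theory.Cong"
begin

text \<open>
  For an Eulerian tournament with out-degrees \<open>d = (n - 1) / 2\<close> and adjacency matrix \<open>A\<close>, put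
  \<open>W = A\<^sup>T - A\<close>. This is a skew-symmetric matrix with entries \<open>\<plusminus>1\<close> off the diagonal and all line sums
  \<open>0\<close>, and twice the Laplacian \<open>d I - A\<close> is \<open>n I + W - J\<close>, where \<open>J\<close> is the all-ones matrix. By the
  matrix-tree theorem (\<open>arb_at_eq_det\<close>) and the constancy of the line sums
  (\<open>det_on_constant_line_sums\<close>), \<open>det (n I + W) = n\<^sup>2 * 2 ^ (n - 1) * arb(T)\<close>.

  Expanding along the diagonal, \<open>det (x I + W)\<close> is the sum of \<open>x ^ (n - |I|) * det W\<^sub>I\<close> over all
  sets \<open>I\<close> of vertices. A real skew-symmetric determinant is nonnegative, and for even \<open>|I|\<close> the integer
  \<open>det W\<^sub>I\<close> is odd, because modulo \<open>2\<close> it depends on \<open>|I|\<close> only; hence it is at least \<open>1\<close>.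
  Bounding each even minor by \<open>1\<close> and each odd one by \<open>0\<close> gives
  \<open>det (x I + W) \<ge> ((x + 1) ^ n + (x - 1) ^ n) / 2\<close>, and \<open>x = n\<close> is the claimed inequality
  (\<open>det_diagonal_plus_skew\<close>).

  Equality means that every even principal minor is \<open>1\<close> and every odd one \<open>0\<close>. Changing the sign of the rows and
  columns indexed by some vertices preserves the minors, so one fixed vertex may be assumed to
  dominate all others. Together with a cyclic triangle it would then produce a minor \<open>9\<close>
  (\<open>det_on_dominated_cycle\<close>), so the switched tournament is a linear order. Being
  Eulerian forces the switched signs to alternate along this order (\<open>balanced_signs_alternate\<close>), so
  \<open>T\<close> is determined up to isomorphism. The swirl tournament has this alternating form: reflecting one half of
  the circle into the other is the switching that turns it into a linear order
  (\<open>swirl_alternating_order\<close>). Conversely, the alternating form gives all minors their extremal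
  values, since those of a linear order are computed directly in \<open>det_on_order_sign\<close>.
\<close>

section \<open>Determinants indexed by finite sets\<close>

text \<open>
  The Leibniz formula over an arbitrary finite index set. Principal minors and vertex-deleted
  matrices are then restrictions of one and the same function, without renumbering.
\<close>

definition det_on :: "'a set \<Rightarrow> ('a \<Rightarrow> 'a \<Rightarrow> 'b::comm_ring_1) \<Rightarrow> 'b" where
  "det_on I M = (\<Sum>p | p permutes I. of_int (sign p) * (\<Prod>i\<in>I. M i (p i)))"

lemma det_on_cong:
  assumes "\<And>i j. i \<in> I \<Longrightarrow> j \<in> I \<Longrightarrow> M i j = N i j"
  shows "det_on I M = det_on I N"
  unfolding det_on_def
  by (intro sum.cong prod.cong refl arg_cong2[where f = "(*)"] assms)
     (auto simp: permutes_in_image)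

lemma det_on_reindex:
  assumes "bij_betw h J I" "finite J"
  shows "det_on I M = det_on J (\<lambda>i j. M (h i) (h j))"
proof -
  have inj: "inj_on h J" and im: "h ` J = I"
    using assms by (auto simp: bij_betw_def)
  have bij: "bij_betw (map_permutation J h) {p. p permutes J} {p. p permutes I}"
    using bij_betw_permutations[OF assms(1)]
    by (rule bij_betw_cong[THEN iffD1, rotated])
       (auto simp: map_permutation_def restrict_id_def im o_def)
  have "det_on I M = (\<Sum>p | p permutes J.
      of_int (sign (map_permutation J h p)) * (\<Prod>i\<in>I. M i (map_permutation J h p i)))"
    unfolding det_on_def by (rule sum.reindex_bij_betw[OF bij, symmetric])
  also have "\<dots> = det_on J (\<lambda>i j. M (h i) (h j))"
    unfolding det_on_def
  proof (intro sum.cong refl arg_cong2[where f = "(*)"])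
    fix p assume "p \<in> {p. p permutes J}"
    then have p: "p permutes J" by simp
    show "of_int (sign (map_permutation J h p)) = (of_int (sign p) :: 'c)"
      using sign_map_permutation[OF inj p assms(2)] by simp
    have "(\<Prod>i\<in>I. M i (map_permutation J h p i)) =
        (\<Prod>i\<in>J. M (h i) (map_permutation J h p (h i)))"
      by (rule prod.reindex_bij_betw[OF assms(1), symmetric])
    also have "\<dots> = (\<Prod>i\<in>J. M (h i) (h (p i)))"
      using inj by (intro prod.cong refl) (simp add: map_permutation_apply)
    finally show "(\<Prod>i\<in>I. M i (map_permutation J h p i)) = (\<Prod>i\<in>J. M (h i) (h (p i)))" .
  qed
  finally show ?thesis .
qed

text \<open>
  Numbering the index set imports multiplicativity, transposition and the kernel criterion
  from the theory of matrices with numbered rows.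
\<close>

lemma det_on_eq_det:
  assumes "bij_betw h {0..<n} I"
  shows "det_on I M = det (mat n n (\<lambda>(i, j). M (h i) (h j)))"
proof -
  have "det_on I M = det_on {0..<n} (\<lambda>i j. M (h i) (h j))"
    by (rule det_on_reindex[OF assms]) simp
  also have "\<dots> = det (mat n n (\<lambda>(i, j). M (h i) (h j)))"
    unfolding det_on_def
    by (subst det_def'[of _ n])
       (auto intro!: sum.cong prod.cong arg_cong2[where f = "(*)"] simp: permutes_in_image[of _ "{0..<n}", simplified])
  finally show ?thesis .
qed

lemma det_on_transpose:
  assumes "finite I"
  shows "det_on I (\<lambda>i j. M j i) = det_on I M"
proof -
  obtain h where h: "bij_betw h {0..<card I} I"
    using ex_bij_betw_nat_finite[OF assms] by blast
  let ?A = "mat (card I) (card I) (\<lambda>(i, j). M (h i) (h j))"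
  have "det_on I (\<lambda>i j. M j i) = det (transpose_mat ?A)"
    unfolding det_on_eq_det[OF h] by (rule arg_cong[where f = det]) auto
  also have "\<dots> = det_on I M"
    unfolding det_on_eq_det[OF h] by (rule det_transpose[of _ "card I"]) simp
  finally show ?thesis .
qed

lemma det_on_mult:
  assumes "finite I"
  shows "det_on I (\<lambda>i j. \<Sum>k\<in>I. A i k * B k j) = det_on I A * det_on I B"
proof -
  obtain h where h: "bij_betw h {0..<card I} I"
    using ex_bij_betw_nat_finite[OF assms] by blast
  let ?m = "\<lambda>M. mat (card I) (card I) (\<lambda>(i, j). M (h i) (h j))"
  have "det_on I (\<lambda>i j. \<Sum>k\<in>I. A i k * B k j) = det (?m A * ?m B)"
    unfolding det_on_eq_det[OF h]
    by (rule arg_cong[where f = det])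
       (auto intro!: eq_matI simp: scalar_prod_def sum.reindex_bij_betw[OF h, symmetric])
  also have "\<dots> = det_on I A * det_on I B"
    unfolding det_on_eq_det[OF h] by (rule det_mult[of _ "card I"]) auto
  finally show ?thesis .
qed

lemma det_on_eq_0_iff:
  fixes M :: "'a \<Rightarrow> 'a \<Rightarrow> 'b::idom"
  assumes "finite I"
  shows "det_on I M = 0 \<longleftrightarrow>
    (\<exists>v. (\<exists>i\<in>I. v i \<noteq> 0) \<and> (\<forall>i\<in>I. (\<Sum>j\<in>I. M i j * v j) = 0))"
proof -
  define n where "n = card I"
  obtain h where h: "bij_betw h {0..<n} I"
    unfolding n_def using ex_bij_betw_nat_finite[OF assms] by blast
  define A where "A = mat n n (\<lambda>(i, j). M (h i) (h j))"
  have I: "I = h ` {0..<n}" and inj: "inj_on h {0..<n}"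
    using h by (auto simp: bij_betw_def)
  have Av: "A *\<^sub>v w = 0\<^sub>v n \<longleftrightarrow> (\<forall>i<n. (\<Sum>j<n. M (h i) (h j) * w $ j) = 0)"
    if "w \<in> carrier_vec n" for w
    using that unfolding A_def
    by (auto simp: vec_eq_iff scalar_prod_def atLeast0LessThan)
  have "det_on I M = 0 \<longleftrightarrow> (\<exists>w. w \<in> carrier_vec n \<and> w \<noteq> 0\<^sub>v n \<and> A *\<^sub>v w = 0\<^sub>v n)"
    unfolding det_on_eq_det[OF h] A_def by (rule det_0_iff_vec_prod_zero) simp
  also have "\<dots> \<longleftrightarrow> (\<exists>v. (\<exists>i\<in>I. v i \<noteq> 0) \<and> (\<forall>i\<in>I. (\<Sum>j\<in>I. M i j * v j) = 0))"
  proof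
    assume "\<exists>w. w \<in> carrier_vec n \<and> w \<noteq> 0\<^sub>v n \<and> A *\<^sub>v w = 0\<^sub>v n"
    then obtain w where w: "w \<in> carrier_vec n" "w \<noteq> 0\<^sub>v n" "A *\<^sub>v w = 0\<^sub>v n" by blast
    define v where "v i = w $ (inv_into {0..<n} h i)" for i
    have v: "v (h i) = w $ i" if "i < n" for i
      using that inj by (simp add: v_def)
    obtain i where "i < n" "w $ i \<noteq> 0" using w by (auto simp: vec_eq_iff)
    then have "\<exists>i\<in>I. v i \<noteq> 0" using v I by auto
    moreover have "\<forall>i\<in>I. (\<Sum>j\<in>I. M i j * v j) = 0"
      using w(3) v unfolding Av[OF w(1)] sum.reindex_bij_betw[OF h, symmetric]
      by (auto simp: atLeast0LessThan I)
    ultimately show "\<exists>v. (\<exists>i\<in>I. v i \<noteq> 0) \<and> (\<forall>i\<in>I. (\<Sum>j\<in>I. M i j * v j) = 0)" by blast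
  next
    assume "\<exists>v. (\<exists>i\<in>I. v i \<noteq> 0) \<and> (\<forall>i\<in>I. (\<Sum>j\<in>I. M i j * v j) = 0)"
    then obtain v where v: "\<exists>i\<in>I. v i \<noteq> 0" "\<forall>i\<in>I. (\<Sum>j\<in>I. M i j * v j) = 0" by blast
    define w where "w = vec n (\<lambda>i. v (h i))"
    have w: "w \<in> carrier_vec n" by (simp add: w_def)
    moreover have "w \<noteq> 0\<^sub>v n" using v(1) by (auto simp: w_def I vec_eq_iff)
    moreover have "A *\<^sub>v w = 0\<^sub>v n"
      using v(2) unfolding Av[OF w] sum.reindex_bij_betw[OF h, symmetric]
      by (auto simp: w_def atLeast0LessThan I)
    ultimately show "\<exists>w. w \<in> carrier_vec n \<and> w \<noteq> 0\<^sub>v n \<and> A *\<^sub>v w = 0\<^sub>v n" by blast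
  qed
  finally show ?thesis .
qed

text \<open>
  The rank \<open>rk\<close> replaces an explicit ordering of the indices. A permutation with a nonzero
  Leibniz term never increases the rank; since it preserves the sum of all ranks, it never
  decreases it either, so it is the identity.
\<close>

lemma det_on_triangular:
  fixes rk :: "'a \<Rightarrow> nat"
  assumes I: "finite I"
    and rk: "\<And>i j. i \<in> I \<Longrightarrow> j \<in> I \<Longrightarrow> i \<noteq> j \<Longrightarrow> M i j \<noteq> 0 \<Longrightarrow> rk j < rk i"
  shows "det_on I M = (\<Prod>i\<in>I. M i i)"
proof -
  have zero: "(\<Prod>i\<in>I. M i (p i)) = 0" if p: "p permutes I" "p \<noteq> id" for p
  proof (rule ccontr)
    assume "(\<Prod>i\<in>I. M i (p i)) \<noteq> 0"
    then have nz: "M i (p i) \<noteq> 0" if "i \<in> I" for i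
      using prod_zero[OF I, of "\<lambda>i. M i (p i)"] that by blast
    have le: "rk (p i) \<le> rk i" if "i \<in> I" for i
      using rk[OF that _ _ nz[OF that]] p that by (cases "p i = i") (auto simp: permutes_in_image)
    obtain i where "p i \<noteq> i" using p(2) by (auto simp: fun_eq_iff)
    then have i: "i \<in> I" using p(1) by (auto simp: permutes_def)
    then have "rk (p i) < rk i"
      using rk[OF i _ _ nz[OF i]] p \<open>p i \<noteq> i\<close> by (auto simp: permutes_in_image)
    then have "(\<Sum>i\<in>I. rk (p i)) < (\<Sum>i\<in>I. rk i)"
      using I i le by (intro sum_strict_mono_ex1) auto
    moreover have "(\<Sum>i\<in>I. rk (p i)) = (\<Sum>i\<in>I. rk i)"
      by (rule sum.reindex_bij_betw[OF permutes_imp_bij[OF p(1)]])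
    ultimately show False by simp
  qed
  have "det_on I M = (\<Sum>p\<in>{id}. of_int (sign p) * (\<Prod>i\<in>I. M i (p i)))"
    unfolding det_on_def using I zero
    by (intro sum.mono_neutral_right) (auto simp: finite_permutations permutes_id)
  then show ?thesis by simp
qed

lemma det_on_add_rows_to_row:
  assumes I: "finite I" "r \<in> I"
  shows "det_on I (\<lambda>i j. if i = r then M r j + (\<Sum>k\<in>I - {r}. c k * M k j) else M i j) = det_on I M"
proof -
  define P where "P i k = (if i = k then 1 else if i = r then c k else 0)" for i k
  have "det_on I P = (\<Prod>i\<in>I. P i i)"
    by (rule det_on_triangular[of _ _ "\<lambda>i. if i = r then 1 else 0"])
       (use I in \<open>auto simp: P_def split: if_splits\<close>)
  then have P: "det_on I P = 1" by (simp add: P_def)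
  have "det_on I (\<lambda>i j. if i = r then M r j + (\<Sum>k\<in>I - {r}. c k * M k j) else M i j) =
    det_on I (\<lambda>i j. \<Sum>k\<in>I. P i k * M k j)"
  proof (rule det_on_cong)
    fix i j assume "i \<in> I"
    show "(if i = r then M r j + (\<Sum>k\<in>I - {r}. c k * M k j) else M i j) = (\<Sum>k\<in>I. P i k * M k j)"
      using I \<open>i \<in> I\<close>
      by (auto simp: P_def sum.remove[of I i] intro!: sum.cong sum.neutral split: if_splits)
  qed
  then show ?thesis by (simp add: det_on_mult[OF I(1)] P)
qed

lemma det_on_add_row_to_rows:
  assumes I: "finite I" "r \<in> I"
  shows "det_on I (\<lambda>i j. if i = r then M r j else M i j + c i * M r j) = det_on I M"
proof -
  define P where "P i k = (if i = k then 1 else if k = r then c i else 0)" for i k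
  have "det_on I P = (\<Prod>i\<in>I. P i i)"
    by (rule det_on_triangular[of _ _ "\<lambda>i. if i = r then 0 else 1"])
       (use I in \<open>auto simp: P_def split: if_splits\<close>)
  then have P: "det_on I P = 1" by (simp add: P_def)
  have "det_on I (\<lambda>i j. if i = r then M r j else M i j + c i * M r j) =
    det_on I (\<lambda>i j. \<Sum>k\<in>I. P i k * M k j)"
  proof (rule det_on_cong)
    fix i j assume i: "i \<in> I"
    show "(if i = r then M r j else M i j + c i * M r j) = (\<Sum>k\<in>I. P i k * M k j)"
    proof (cases "i = r")
      case True
      then show ?thesis using I by (auto simp: P_def sum.remove[of I r] intro!: sum.neutral split: if_splits)
    next
      case False
      then have "(\<Sum>k\<in>I. P i k * M k j) = P i i * M i j + (P i r * M r j + (\<Sum>k\<in>I - {i} - {r}. P i k * M k j))"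
        using I i by (simp add: sum.remove[of I i] sum.remove[of "I - {i}" r])
      also have "(\<Sum>k\<in>I - {i} - {r}. P i k * M k j) = 0"
        by (rule sum.neutral) (auto simp: P_def)
      finally show ?thesis using False by (simp add: P_def)
    qed
  qed
  then show ?thesis by (simp add: det_on_mult[OF I(1)] P)
qed

lemma permutations_fixing:
  assumes "J \<subseteq> I"
  shows "{p. p permutes I \<and> (\<forall>i\<in>I - J. p i = i)} = {p. p permutes J}"
  using assms by (auto intro: permutes_superset permutes_subset simp: permutes_not_in)

lemma det_on_column_expand:
  assumes I: "finite I" "r \<in> I" and zero: "\<And>i. i \<in> I - {r} \<Longrightarrow> M i r = 0"
  shows "det_on I M = M r r * det_on (I - {r}) M"
proof -
  have "det_on I M = (\<Sum>p | p permutes I \<and> (\<forall>i\<in>I - (I - {r}). p i = i).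
      of_int (sign p) * (\<Prod>i\<in>I. M i (p i)))"
    unfolding det_on_def
  proof (rule sum.mono_neutral_right)
    show "\<forall>p\<in>{p. p permutes I} - {p. p permutes I \<and> (\<forall>i\<in>I - (I - {r}). p i = i)}.
       of_int (sign p) * (\<Prod>i\<in>I. M i (p i)) = 0"
    proof
      fix p assume "p \<in> {p. p permutes I} - {p. p permutes I \<and> (\<forall>i\<in>I - (I - {r}). p i = i)}"
      then have p: "p permutes I" "p r \<noteq> r" by auto
      obtain i where "i \<in> I" "p i = r"
        using permutes_image[OF p(1)] I(2) by (metis image_iff)
      then have "i \<in> I - {r}" "p i = r" using p(2) by auto
      then have "(\<Prod>i\<in>I. M i (p i)) = 0"
        using I zero by (intro prod_zero) (auto intro!: bexI[of _ i])
      then show "of_int (sign p) * (\<Prod>i\<in>I. M i (p i)) = 0" by simp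
    qed
  qed (use I in \<open>auto simp: finite_permutations\<close>)
  also have "\<dots> = (\<Sum>p | p permutes (I - {r}). of_int (sign p) * (\<Prod>i\<in>I. M i (p i)))"
    by (subst permutations_fixing) auto
  also have "\<dots> = (\<Sum>p | p permutes (I - {r}). M r r * (of_int (sign p) * (\<Prod>i\<in>I - {r}. M i (p i))))"
    using I by (intro sum.cong refl)
      (auto simp: prod.remove[of I r] permutes_not_in algebra_simps)
  finally show ?thesis by (simp add: det_on_def sum_distrib_left)
qed

text \<open>
  Choosing in each factor of the Leibniz formula either the diagonal summand or the entry of \<open>B\<close>
  forces the permutation to fix the indices of the first kind, leaving a permutation of the others.
\<close>

lemma det_on_diagonal_plus:
  assumes V: "finite V"
  shows "det_on V (\<lambda>i j. (if i = j then x else 0) + B i j) =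
    (\<Sum>I\<in>Pow V. x ^ card (V - I) * det_on I B)"
proof -
  let ?D = "\<lambda>i j. if i = j then x else 0"
  have "det_on V (\<lambda>i j. ?D i j + B i j) =
     (\<Sum>p | p permutes V. \<Sum>I\<in>Pow V. of_int (sign p) * ((\<Prod>i\<in>I. B i (p i)) * (\<Prod>i\<in>V - I. ?D i (p i))))"
    unfolding det_on_def
    by (subst add.commute, subst prod_add[OF V]) (simp add: sum_distrib_left)
  also have "\<dots> = (\<Sum>I\<in>Pow V. \<Sum>p | p permutes V.
      of_int (sign p) * ((\<Prod>i\<in>I. B i (p i)) * (\<Prod>i\<in>V - I. ?D i (p i))))"
    by (rule sum.swap)
  also have "\<dots> = (\<Sum>I\<in>Pow V. x ^ card (V - I) * det_on I B)"
  proof (rule sum.cong[OF refl])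
    fix I assume "I \<in> Pow V"
    then have I: "I \<subseteq> V" "finite (V - I)" using V by auto
    have "(\<Sum>p | p permutes V. of_int (sign p) * ((\<Prod>i\<in>I. B i (p i)) * (\<Prod>i\<in>V - I. ?D i (p i)))) =
      (\<Sum>p | p permutes V \<and> (\<forall>i\<in>V - I. p i = i).
        of_int (sign p) * ((\<Prod>i\<in>I. B i (p i)) * (\<Prod>i\<in>V - I. ?D i (p i))))"
    proof (rule sum.mono_neutral_right)
      show "\<forall>p\<in>{p. p permutes V} - {p. p permutes V \<and> (\<forall>i\<in>V - I. p i = i)}.
         of_int (sign p) * ((\<Prod>i\<in>I. B i (p i)) * (\<Prod>i\<in>V - I. ?D i (p i))) = 0"
      proof
        fix p assume "p \<in> {p. p permutes V} - {p. p permutes V \<and> (\<forall>i\<in>V - I. p i = i)}"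
        then obtain i where "i \<in> V - I" "p i \<noteq> i" by auto
        then have "(\<Prod>i\<in>V - I. ?D i (p i)) = 0"
          using I(2) by (intro prod_zero) (auto intro!: bexI[of _ i])
        then show "of_int (sign p) * ((\<Prod>i\<in>I. B i (p i)) * (\<Prod>i\<in>V - I. ?D i (p i))) = 0" by simp
      qed
    qed (use V in \<open>auto simp: finite_permutations\<close>)
    also have "\<dots> = (\<Sum>p | p permutes I. x ^ card (V - I) * (of_int (sign p) * (\<Prod>i\<in>I. B i (p i))))"
      unfolding permutations_fixing[OF I(1)]
      by (intro sum.cong refl) (auto simp: permutes_not_in algebra_simps)
    finally show "(\<Sum>p | p permutes V. of_int (sign p) * ((\<Prod>i\<in>I. B i (p i)) * (\<Prod>i\<in>V - I. ?D i (p i)))) =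
      x ^ card (V - I) * det_on I B"
      by (simp add: det_on_def sum_distrib_left)
  qed
  finally show ?thesis .
qed

lemma det_on_scale:
  assumes "finite I"
  shows "det_on I (\<lambda>i j. e i * M i j * f j) = (\<Prod>i\<in>I. e i) * (\<Prod>i\<in>I. f i) * det_on I M"
proof -
  have "(\<Prod>i\<in>I. f (p i)) = (\<Prod>i\<in>I. f i)" if "p permutes I" for p
    using prod.reindex_bij_betw[OF permutes_imp_bij[OF that]] .
  then show ?thesis
    unfolding det_on_def sum_distrib_left
    by (intro sum.cong refl) (simp add: prod.distrib algebra_simps)
qed

lemma of_int_det_on: "of_int (det_on I M) = det_on I (\<lambda>i j. of_int (M i j))"
  by (simp add: det_on_def)

text \<open>
  Replacing row \<open>r\<close> by the sum of all rows and then column \<open>r\<close> by the sum of all columns makes both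
  of them constantly \<open>x\<close> except for the entry \<open>card V * x\<close> in the corner. Clearing column \<open>r\<close> with
  row \<open>r\<close> subtracts \<open>x / card V\<close> from every remaining entry.
\<close>

lemma det_on_constant_line_sums:
  fixes M :: "'a \<Rightarrow> 'a \<Rightarrow> real"
  assumes V: "finite V" "r \<in> V"
    and row: "\<And>i. i \<in> V \<Longrightarrow> (\<Sum>j\<in>V. M i j) = x"
    and col: "\<And>j. j \<in> V \<Longrightarrow> (\<Sum>i\<in>V. M i j) = x"
  shows "det_on V M = real (card V) * x * det_on (V - {r}) (\<lambda>i j. M i j - x / real (card V))"
proof -
  have n: "real (card V) > 0" using V by (auto simp: card_gt_0_iff)
  define M1 where "M1 i j = (if i = r then x else M i j)" for i j
  define M2 where "M2 i j = (if j = r then (if i = r then real (card V) * x else x) else M1 i j)" for i j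
  define M3 where "M3 i j = (if i = r then M2 r j else M2 i j + (- 1 / real (card V)) * M2 r j)" for i j
  \<comment> \<open>Row \<open>r\<close> becomes the sum of all rows.\<close>
  have "det_on V M = det_on V (\<lambda>i j. if i = r then M r j + (\<Sum>k\<in>V - {r}. 1 * M k j) else M i j)"
    by (rule det_on_add_rows_to_row[OF V, symmetric])
  also have "\<dots> = det_on V M1"
  proof (rule det_on_cong)
    fix i j assume "j \<in> V"
    have "M r j + (\<Sum>k\<in>V - {r}. 1 * M k j) = x"
      using V col[OF \<open>j \<in> V\<close>] by (simp add: sum.remove[of V r])
    then show "(if i = r then M r j + (\<Sum>k\<in>V - {r}. 1 * M k j) else M i j) = M1 i j"
      by (simp add: M1_def)
  qed
  also have "\<dots> = det_on V (\<lambda>i j. M1 j i)"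
    by (rule det_on_transpose[OF V(1), symmetric])
  \<comment> \<open>The same for column \<open>r\<close>, through the transpose.\<close>
  also have "\<dots> = det_on V (\<lambda>i j. if i = r then M1 j r + (\<Sum>k\<in>V - {r}. 1 * M1 j k) else M1 j i)"
    by (rule det_on_add_rows_to_row[OF V, symmetric])
  also have "\<dots> = det_on V (\<lambda>i j. M2 j i)"
  proof (rule det_on_cong)
    fix i j assume "i \<in> V" "j \<in> V"
    have "M1 j r + (\<Sum>k\<in>V - {r}. 1 * M1 j k) = (\<Sum>k\<in>V. M1 j k)"
      using V by (simp add: sum.remove[of V r])
    also have "\<dots> = (if j = r then real (card V) * x else x)"
      using row[OF \<open>j \<in> V\<close>] by (simp add: M1_def)
    finally show "(if i = r then M1 j r + (\<Sum>k\<in>V - {r}. 1 * M1 j k) else M1 j i) = M2 j i"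
      by (simp add: M2_def)
  qed
  also have "\<dots> = det_on V M2" by (rule det_on_transpose[OF V(1)])
  also have "\<dots> = det_on V M3"
    unfolding M3_def by (rule det_on_add_row_to_rows[OF V, symmetric])
  also have "\<dots> = M3 r r * det_on (V - {r}) M3"
    by (rule det_on_column_expand[OF V]) (use n in \<open>auto simp: M3_def M2_def\<close>)
  also have "M3 r r = real (card V) * x" by (simp add: M3_def M2_def)
  also have "det_on (V - {r}) M3 = det_on (V - {r}) (\<lambda>i j. M i j - x / real (card V))"
    by (rule det_on_cong) (auto simp: M3_def M2_def M1_def)
  finally show ?thesis .
qed

section \<open>Skew-symmetric integer matrices with odd off-diagonal entries\<close>

text \<open>
  On the segment from the identity matrix to \<open>W\<close> every matrix before the end point is
  nonsingular: its quadratic form is \<open>1 - t\<close> times the sum of squares, because the skew part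
  contributes nothing. So the determinant, which starts at \<open>1\<close>, cannot become negative.
\<close>

lemma det_on_skew_nonneg:
  fixes W :: "'a \<Rightarrow> 'a \<Rightarrow> real"
  assumes I: "finite I" and skew: "\<And>i j. i \<in> I \<Longrightarrow> j \<in> I \<Longrightarrow> W i j = - W j i"
  shows "det_on I W \<ge> 0"
proof (rule ccontr)
  assume neg: "\<not> det_on I W \<ge> 0"
  define h where "h t = det_on I (\<lambda>i j. (if i = j then 1 - t else 0) + t * W i j)" for t :: real
  have nonsing: "h t \<noteq> 0" if "0 \<le> t" "t < 1" for t
  proof
    assume "h t = 0"
    then obtain v where v: "\<exists>i\<in>I. v i \<noteq> 0"
      and ker: "\<And>i. i \<in> I \<Longrightarrow> (\<Sum>j\<in>I. ((if i = j then 1 - t else 0) + t * W i j) * v j) = 0"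
      unfolding h_def det_on_eq_0_iff[OF I] by blast
    \<comment> \<open>The quadratic form of a skew matrix vanishes, as transposing the double sum negates it.\<close>
    have form: "(\<Sum>i\<in>I. \<Sum>j\<in>I. v i * W i j * v j) = 0"
    proof -
      have "(\<Sum>i\<in>I. \<Sum>j\<in>I. v i * W i j * v j) = (\<Sum>i\<in>I. \<Sum>j\<in>I. v j * W j i * v i)"
        by (rule sum.swap)
      also have "\<dots> = (\<Sum>i\<in>I. \<Sum>j\<in>I. - (v i * W i j * v j))"
        by (intro sum.cong refl) (subst skew, auto)
      also have "\<dots> = - (\<Sum>i\<in>I. \<Sum>j\<in>I. v i * W i j * v j)" by (simp add: sum_negf)
      finally show ?thesis by simp
    qed
    have "0 = (\<Sum>i\<in>I. v i * (\<Sum>j\<in>I. ((if i = j then 1 - t else 0) + t * W i j) * v j))"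
      using ker by simp
    also have "\<dots> = (\<Sum>i\<in>I. v i * ((1 - t) * v i + t * (\<Sum>j\<in>I. W i j * v j)))"
    proof (intro sum.cong refl arg_cong2[where f = "(*)"])
      fix i assume "i \<in> I"
      have "(\<Sum>j\<in>I. ((if i = j then 1 - t else 0) + t * W i j) * v j) =
          (\<Sum>j\<in>I. (if i = j then (1 - t) * v j else 0)) + (\<Sum>j\<in>I. t * (W i j * v j))"
        by (subst sum.distrib[symmetric]) (auto intro!: sum.cong simp: algebra_simps)
      then show "(\<Sum>j\<in>I. ((if i = j then 1 - t else 0) + t * W i j) * v j) =
          (1 - t) * v i + t * (\<Sum>j\<in>I. W i j * v j)"
        using I \<open>i \<in> I\<close> by (simp add: sum_distrib_left)
    qed
    also have "\<dots> = (1 - t) * (\<Sum>i\<in>I. (v i)\<^sup>2) + t * (\<Sum>i\<in>I. \<Sum>j\<in>I. v i * W i j * v j)"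
      by (simp add: sum_distrib_left sum.distrib sum_subtractf algebra_simps power2_eq_square)
    finally have "(1 - t) * (\<Sum>i\<in>I. (v i)\<^sup>2) = 0" using form by simp
    moreover have "(\<Sum>i\<in>I. (v i)\<^sup>2) > 0"
    proof -
      obtain i where "i \<in> I" "v i \<noteq> 0" using v by blast
      then show ?thesis by (intro sum_pos2[OF I, of i]) auto
    qed
    ultimately show False using \<open>t < 1\<close> by simp
  qed
  have "continuous_on {0..1} (\<lambda>t::real. if P then 1 - t else 0)" for P
    by (cases P) (auto intro!: continuous_intros)
  then have "continuous_on {0..1} h"
    unfolding h_def det_on_def by (intro continuous_intros)
  moreover have "h 0 = 1"
    unfolding h_def
    by (subst det_on_triangular[OF I, where rk = "\<lambda>_. 0"]) (auto split: if_splits)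
  moreover have "h 1 = det_on I W" unfolding h_def by (rule det_on_cong) simp
  ultimately obtain t where "0 \<le> t" "t \<le> 1" "h t = 0"
    using IVT2'[of h 1 0 0] neg by auto
  then show False using nonsing[of t] neg \<open>h 1 = det_on I W\<close> by (cases "t = 1") auto
qed

text \<open>
  The skew matrix of the linear order that an injective \<open>p\<close> induces; it is the reference point of
  the extremal problem, since it attains the bounds for all principal minors simultaneously.
\<close>

definition order_sign :: "('a \<Rightarrow> nat) \<Rightarrow> 'a \<Rightarrow> 'a \<Rightarrow> 'b::comm_ring_1" where
  "order_sign p i j = (if p i < p j then 1 else if p j < p i then - 1 else 0)"

text \<open>
  Let \<open>a\<close> and \<open>b\<close> be the two smallest indices. Their rows differ in the columns \<open>a\<close> and \<open>b\<close> only, so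
  subtracting row \<open>b\<close> from row \<open>a\<close> leaves the row \<open>(1, 1, 0, \<dots>, 0)\<close>. Adding it to all other rows
  clears the columns \<open>a\<close> and \<open>b\<close> below a unipotent \<open>2 \<times> 2\<close> block and leaves the rest of the
  matrix as it was. Hence the determinant only depends on the parity of the size.
\<close>

lemma det_on_order_sign:
  assumes "finite I" "inj_on p I"
  shows "det_on I (order_sign p) = of_bool (even (card I))"
  using assms
proof (induction "card I" arbitrary: I rule: less_induct)
  case (less I)
  let ?M = "order_sign p :: 'a \<Rightarrow> 'a \<Rightarrow> 'b"
  consider "I = {}" | a where "I = {a}" | "card I \<ge> 2"
  proof -
    have "card I = 0 \<or> card I = 1 \<or> card I \<ge> 2" by linarith
    then show thesis using that less.prems(1) by (auto simp: card_1_singleton_iff)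
  qed
  then show ?case
  proof cases
    case 1
    then show ?thesis by (simp add: det_on_def)
  next
    case (2 a)
    then show ?thesis by (simp add: det_on_def order_sign_def)
  next
    case 3
    then have "I \<noteq> {}" by auto
    then obtain a where a: "a \<in> I" "\<And>x. x \<in> I \<Longrightarrow> p a \<le> p x"
      using arg_min_if_finite[OF less.prems(1), of p] by (metis not_le)
    have "card (I - {a}) > 0" using 3 a(1) less.prems(1) by simp
    then have "I - {a} \<noteq> {}" by force
    then obtain b where b: "b \<in> I - {a}" "\<And>x. x \<in> I - {a} \<Longrightarrow> p b \<le> p x"
      using arg_min_if_finite[of "I - {a}" p] less.prems(1) by (metis finite_Diff not_le)
    have ax: "p a < p x" if "x \<in> I" "x \<noteq> a" for x
    proof -
      have "p a \<noteq> p x" using that a(1) less.prems(2) by (auto dest: inj_onD)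
      moreover have "p a \<le> p x" using a(2) that by simp
      ultimately show ?thesis by simp
    qed
    have ab: "p a < p b" using ax b(1) by simp
    have bx: "p b < p x" if "x \<in> I" "x \<noteq> a" "x \<noteq> b" for x
    proof -
      have "p b \<noteq> p x" using that b(1) less.prems(2) by (auto dest: inj_onD)
      moreover have "p b \<le> p x" using b(2) that by simp
      ultimately show ?thesis by simp
    qed
    define N where "N i j = (if i = a then ?M a j + (\<Sum>k\<in>I - {a}. (if k = b then - 1 else 0) * ?M k j)
      else ?M i j)" for i j
    define N' where "N' i j = (if i = a then N a j else N i j + 1 * N a j)" for i j
    have Na: "N a j = (if j = a \<or> j = b then 1 else 0)" if "j \<in> I" for j
    proof -
      have "(\<Sum>k\<in>I - {a}. (if k = b then - 1 else 0) * ?M k j) = (\<Sum>k\<in>I - {a}. (if k = b then - ?M k j else 0))"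
        by (intro sum.cong refl) auto
      also have "\<dots> = - ?M b j" using b less.prems(1) by simp
      finally have "N a j = ?M a j - ?M b j" by (simp add: N_def)
      then show ?thesis
        using ab ax[OF that] bx[OF that] unfolding order_sign_def
        by (cases "j = a"; cases "j = b") auto
    qed
    have "det_on I ?M = det_on I N'"
      unfolding N'_def N_def
      by (subst det_on_add_row_to_rows[OF less.prems(1) a(1)],
          subst det_on_add_rows_to_row[OF less.prems(1) a(1)]) simp
    also have "\<dots> = N' a a * det_on (I - {a}) N'"
    proof (rule det_on_column_expand[OF less.prems(1) a(1)])
      fix i assume "i \<in> I - {a}"
      then show "N' i a = 0"
        using ab ax[of i] a(1) by (auto simp: N'_def Na, auto simp: N_def order_sign_def)
    qed
    also have "det_on (I - {a}) N' = N' b b * det_on (I - {a} - {b}) N'"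
    proof (rule det_on_column_expand)
      fix i assume "i \<in> I - {a} - {b}"
      then show "N' i b = 0"
        using bx[of i] b(1) by (auto simp: N'_def Na, auto simp: N_def order_sign_def)
    qed (use b less.prems in auto)
    also have "det_on (I - {a} - {b}) N' = det_on (I - {a} - {b}) ?M"
      by (rule det_on_cong) (auto simp: N'_def Na, auto simp: N_def)
    also have "\<dots> = of_bool (even (card (I - {a} - {b})))"
      using less.prems a(1) b(1) 3 by (intro less.hyps) (auto intro: inj_on_subset)
    also have "card (I - {a} - {b}) = card I - 2"
      using a(1) b(1) less.prems(1) by (simp add: card_Diff_singleton)
    also have "N' a a = 1" using a(1) by (simp add: N'_def Na)
    also have "N' b b = 1" using a(1) b(1) ab by (auto simp: N'_def Na, auto simp: N_def order_sign_def)
    also have "even (card I - 2) \<longleftrightarrow> even (card I)"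
      using 3 by presburger
    finally show ?thesis by simp
  qed
qed

text \<open>
  Modulo \<open>2\<close> the matrix agrees with the matrix of any linear order, whose determinant is \<open>1\<close>.
\<close>

lemma odd_det_on_even_card:
  fixes W :: "'a \<Rightarrow> 'a \<Rightarrow> int"
  assumes I: "finite I" "even (card I)"
    and W: "\<And>i j. i \<in> I \<Longrightarrow> j \<in> I \<Longrightarrow> odd (W i j) \<longleftrightarrow> i \<noteq> j"
  shows "odd (det_on I W)"
proof -
  obtain p :: "'a \<Rightarrow> nat" where p: "inj_on p I"
    using finite_imp_inj_to_nat_seg[OF I(1)] by blast
  have "[W i j = order_sign p i j] (mod 2)" if "i \<in> I" "j \<in> I" for i j
    using W[OF that] inj_onD[OF p _ that]
    by (auto simp: order_sign_def cong_def even_iff_mod_2_eq_zero odd_iff_mod_2_eq_one)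
  then have "[det_on I W = det_on I (order_sign p)] (mod 2)"
    unfolding det_on_def
    by (intro cong_sum cong_mult cong_prod cong_refl) (auto simp: permutes_in_image)
  then have "[det_on I W = 1] (mod 2)"
    using det_on_order_sign[OF I(1) p, where ?'b = int] I(2) by simp
  then show ?thesis by (simp add: cong_def odd_iff_mod_2_eq_one)
qed

text \<open>
  A nonnegative odd integer is at least \<open>1\<close>.
\<close>

lemma det_on_skew_ge:
  fixes W :: "'a \<Rightarrow> 'a \<Rightarrow> int"
  assumes I: "finite I" and skew: "\<And>i j. i \<in> I \<Longrightarrow> j \<in> I \<Longrightarrow> W i j = - W j i"
    and odd: "\<And>i j. i \<in> I \<Longrightarrow> j \<in> I \<Longrightarrow> odd (W i j) \<longleftrightarrow> i \<noteq> j"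
  shows "det_on I W \<ge> of_bool (even (card I))"
proof -
  have "real_of_int (det_on I W) \<ge> 0"
    unfolding of_int_det_on by (rule det_on_skew_nonneg[OF I]) (subst skew, auto)
  then have nonneg: "det_on I W \<ge> 0" by simp
  show ?thesis
  proof (cases "even (card I)")
    case True
    then have "odd (det_on I W)"
      using odd_det_on_even_card[of I W] I odd by blast
    then have "det_on I W \<noteq> 0" by (metis even_zero)
    then show ?thesis using nonneg True by simp
  next
    case False
    then show ?thesis using nonneg by simp
  qed
qed

text \<open>
  This is the average of the expansions of \<open>(1 + x) ^ n\<close> and \<open>(- 1 + x) ^ n\<close> over subsets.
\<close>

lemma sum_even_subsets:
  fixes x :: real
  assumes "finite V"
  shows "(\<Sum>I\<in>Pow V. x ^ card (V - I) * of_bool (even (card I))) =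
    ((x + 1) ^ card V + (x - 1) ^ card V) / 2"
proof -
  have "(c + x) ^ card V = (\<Sum>I\<in>Pow V. c ^ card I * x ^ card (V - I))" for c
    using prod_add[OF assms, of "\<lambda>_. c" "\<lambda>_. x"] by simp
  from this[of 1] this[of "-1"]
  have "(x + 1) ^ card V + (x - 1) ^ card V =
     (\<Sum>I\<in>Pow V. 1 ^ card I * x ^ card (V - I)) + (\<Sum>I\<in>Pow V. (-1) ^ card I * x ^ card (V - I))"
    by (simp add: add.commute)
  also have "\<dots> = (\<Sum>I\<in>Pow V. 2 * (x ^ card (V - I) * of_bool (even (card I))))"
    by (subst sum.distrib[symmetric]) (auto intro!: sum.cong simp: minus_one_power_iff)
  also have "\<dots> = 2 * (\<Sum>I\<in>Pow V. x ^ card (V - I) * of_bool (even (card I)))"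
    by (rule sum_distrib_left[symmetric])
  finally show ?thesis by simp
qed

text \<open>
  Both claims come from comparing the diagonal expansion minor by minor with the bounds of
  \<open>det_on_skew_ge\<close>: all weights are positive, so equality holds only if it holds for every minor.
\<close>

lemma det_diagonal_plus_skew:
  fixes W :: "'a \<Rightarrow> 'a \<Rightarrow> int" and x :: real and V :: "'a set"
  defines "D \<equiv> det_on V (\<lambda>i j. (if i = j then x else 0) + of_int (W i j))"
  assumes V: "finite V" and skew: "\<And>i j. i \<in> V \<Longrightarrow> j \<in> V \<Longrightarrow> W i j = - W j i"
    and odd: "\<And>i j. i \<in> V \<Longrightarrow> j \<in> V \<Longrightarrow> odd (W i j) \<longleftrightarrow> i \<noteq> j"
    and x: "x > 0"
  shows "D \<ge> ((x + 1) ^ card V + (x - 1) ^ card V) / 2" (is ?bound)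
    and "D = ((x + 1) ^ card V + (x - 1) ^ card V) / 2 \<longleftrightarrow>
      (\<forall>I\<subseteq>V. det_on I W = of_bool (even (card I)))" (is ?equality)
proof -
  let ?gap = "\<lambda>I. x ^ card (V - I) * (of_int (det_on I W) - of_bool (even (card I)))"
  have D: "D = (\<Sum>I\<in>Pow V. x ^ card (V - I) * of_int (det_on I W))"
    unfolding D_def det_on_diagonal_plus[OF V] of_int_det_on ..
  have gap: "D - ((x + 1) ^ card V + (x - 1) ^ card V) / 2 = sum ?gap (Pow V)"
    unfolding D sum_even_subsets[OF V, symmetric] sum_subtractf[symmetric]
    by (simp add: right_diff_distrib)
  have nonneg: "?gap I \<ge> 0" if "I \<in> Pow V" for I
  proof -
    have "det_on I W \<ge> of_bool (even (card I))"
      using that V by (intro det_on_skew_ge skew odd) (blast intro: finite_subset)+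
    then have "real_of_int (det_on I W) \<ge> real_of_int (of_bool (even (card I)))"
      by (rule of_int_le_iff[THEN iffD2])
    then show ?thesis using x by simp
  qed
  have "sum ?gap (Pow V) \<ge> 0" by (rule sum_nonneg) (rule nonneg)
  then show ?bound using gap by linarith
  have "D = ((x + 1) ^ card V + (x - 1) ^ card V) / 2 \<longleftrightarrow> sum ?gap (Pow V) = 0"
    using gap by linarith
  also have "\<dots> \<longleftrightarrow> (\<forall>I\<in>Pow V. ?gap I = 0)"
    using V nonneg by (intro sum_nonneg_eq_0_iff) auto
  also have "\<dots> \<longleftrightarrow> (\<forall>I\<subseteq>V. det_on I W = of_bool (even (card I)))"
  proof -
    have "real_of_int d = of_bool b \<longleftrightarrow> d = of_bool b" for d b
      by (cases b) simp_all
    then show ?thesis using x by (simp add: Pow_def)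
  qed
  finally show ?equality .
qed

text \<open>
  The four-vertex obstruction: a vertex dominating a cyclic triangle has a skew matrix with
  Pfaffian \<open>\<plusminus>3\<close>, not \<open>\<plusminus>1\<close>.
\<close>

lemma det_on_dominated_cycle:
  fixes W :: "'a \<Rightarrow> 'a \<Rightarrow> int"
  assumes distinct: "r \<noteq> a" "r \<noteq> b" "r \<noteq> c" "a \<noteq> b" "b \<noteq> c" "a \<noteq> c"
    and skew: "\<And>i j. i \<in> {r, a, b, c} \<Longrightarrow> j \<in> {r, a, b, c} \<Longrightarrow> W i j = - W j i"
    and dom: "W r a = 1" "W r b = 1" "W r c = 1"
    and cycle: "W a b = 1" "W b c = 1" "W c a = 1"
  shows "det_on {r, a, b, c} W = 9"
proof -
  have W: "W a r = -1" "W b r = -1" "W c r = -1" "W b a = -1" "W c b = -1" "W a c = -1"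
    using skew[of a r] skew[of b r] skew[of c r] skew[of b a] skew[of c b] skew[of a c] dom cycle by auto
  have diag: "W r r = 0" "W a a = 0" "W b b = 0" "W c c = 0"
    using skew[of r r] skew[of a a] skew[of b b] skew[of c c] by auto
  have f: "finite {a, b, c}" "finite {b, c}" "finite {c}" "r \<notin> {a, b, c}" "a \<notin> {b, c}" "b \<notin> {c}"
    using distinct by auto
  show ?thesis
    unfolding det_on_def sum_over_permutations_insert[OF f(1,4)]
      sum_over_permutations_insert[OF f(2,5)] sum_over_permutations_insert[OF f(3,6)] permutes_sing
    using distinct distinct[symmetric]
    by (simp add: sign_swap_id permutation_swap_id sign_compose sign_id permutation_compose
        Transposition.transpose_def W dom cycle diag)
qed

section \<open>The matrix-tree theorem for directed graphs\<close>

definition fun_arcs :: "'a set \<Rightarrow> ('a \<Rightarrow> 'a) \<Rightarrow> 'a rel" where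
  "fun_arcs U f = (\<lambda>u. (u, f u)) ` U"

text \<open>
  A function \<open>f\<close> chooses one outgoing arc at every vertex other than \<open>r\<close>. It describes a tree directed
  towards \<open>r\<close> precisely when following the chosen arcs always leads to \<open>r\<close>.
\<close>

definition rooted :: "'a set \<Rightarrow> 'a \<Rightarrow> ('a \<Rightarrow> 'a) \<Rightarrow> bool" where
  "rooted V r f \<longleftrightarrow> (\<forall>u\<in>V. (u, r) \<in> (fun_arcs (V - {r}) f)\<^sup>*)"

lemma in_fun_arcs [simp]: "(u, v) \<in> fun_arcs U f \<longleftrightarrow> u \<in> U \<and> v = f u"
  by (auto simp: fun_arcs_def)

lemma rtrancl_fun_arcs_step:
  assumes "u \<in> V - {r}"
  shows "(u, r) \<in> (fun_arcs (V - {r}) f)\<^sup>* \<longleftrightarrow> (f u, r) \<in> (fun_arcs (V - {r}) f)\<^sup>*"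
  using assms by (auto elim: converse_rtranclE intro: converse_rtrancl_into_rtrancl)

text \<open>
  The distance to the root serves as a rank function both for the triangular
  determinant and for excluding cycles.
\<close>

lemma rooted_decreasing:
  assumes "rooted V r f" "\<And>u. u \<in> V - {r} \<Longrightarrow> f u \<in> V"
  obtains d :: "'a \<Rightarrow> nat" where "\<And>u. u \<in> V - {r} \<Longrightarrow> d (f u) < d u"
proof
  let ?R = "fun_arcs (V - {r}) f"
  define d where "d u = (LEAST k. (u, r) \<in> ?R ^^ k)" for u
  fix u assume u: "u \<in> V - {r}"
  then have "(u, r) \<in> ?R\<^sup>*" using assms(1) by (auto simp: rooted_def)
  then obtain k where "(u, r) \<in> ?R ^^ k" by (auto simp: rtrancl_power)
  then have du: "(u, r) \<in> ?R ^^ d u" unfolding d_def by (rule LeastI)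
  moreover have "d u \<noteq> 0"
  proof
    assume "d u = 0"
    with du u show False by auto
  qed
  ultimately obtain m where m: "d u = Suc m" "(u, r) \<in> ?R ^^ Suc m"
    by (cases "d u") auto
  from m(2) obtain y where "(u, y) \<in> ?R" "(y, r) \<in> ?R ^^ m" by (rule relpow_Suc_E2)
  then have "(f u, r) \<in> ?R ^^ m" by simp
  then have "d (f u) \<le> m" unfolding d_def by (rule Least_le)
  then show "d (f u) < d u" using m by simp
qed

text \<open>
  If all vertices lead to \<open>r\<close>, the matrix is triangular with respect to the distance to \<open>r\<close>. Otherwise
  the set of vertices that do not lead to \<open>r\<close> is closed under \<open>f\<close> and under preimages, and
  its indicator function lies in the kernel.
\<close>

lemma det_on_rooted:
  assumes V: "finite V" "r \<in> V" and f: "\<And>u. u \<in> V - {r} \<Longrightarrow> f u \<in> V"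
  shows "det_on (V - {r}) (\<lambda>i j. of_bool (i = j) - of_bool (f i = j)) = (of_bool (rooted V r f) :: int)"
    (is "det_on ?U ?M = _")
proof (cases "rooted V r f")
  case True
  then obtain d :: "'a \<Rightarrow> nat" where d: "\<And>u. u \<in> ?U \<Longrightarrow> d (f u) < d u"
    using rooted_decreasing[OF True f] by blast
  have "det_on ?U ?M = (\<Prod>i\<in>?U. ?M i i)"
    by (rule det_on_triangular[where rk = d]) (use V d in \<open>auto split: if_splits\<close>)
  also have "\<dots> = 1"
  proof (rule prod.neutral, rule ballI)
    fix u assume "u \<in> ?U"
    then have "f u \<noteq> u" using d[of u] by auto
    then show "?M u u = 1" by simp
  qed
  finally show ?thesis using True by simp
next
  case False
  define v :: "'a \<Rightarrow> int" where "v u = of_bool ((u, r) \<notin> (fun_arcs ?U f)\<^sup>*)" for u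
  have vr: "v r = 0" by (simp add: v_def)
  have step: "v (f u) = v u" if "u \<in> ?U" for u
    using rtrancl_fun_arcs_step[OF that] by (simp add: v_def)
  have "det_on ?U ?M = 0"
    unfolding det_on_eq_0_iff[OF finite_Diff[OF V(1)]]
  proof (intro exI conjI ballI)
    obtain u where u: "u \<in> V" "(u, r) \<notin> (fun_arcs ?U f)\<^sup>*"
      using False by (auto simp: rooted_def)
    then have "u \<noteq> r" by auto
    then show "\<exists>u\<in>?U. v u \<noteq> 0" using u by (auto simp: v_def)
    fix i assume i: "i \<in> ?U"
    have "(\<Sum>j\<in>?U. ?M i j * v j) = (\<Sum>j\<in>V. ?M i j * v j)"
      using V vr by (intro sum.mono_neutral_left) auto
    also have "\<dots> = (\<Sum>j\<in>V. if i = j then v j else 0) - (\<Sum>j\<in>V. if f i = j then v j else 0)"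
      unfolding sum_subtractf[symmetric] by (intro sum.cong) auto
    also have "\<dots> = v i - v (f i)" using V(1) i f[OF i] by simp
    finally show "(\<Sum>j\<in>?U. ?M i j * v j) = 0" using step[OF i] by simp
  qed
  then show ?thesis using False by simp
qed

text \<open>
  Row \<open>i\<close> of the Laplacian is the sum of the rows \<open>e\<^sub>i - e\<^sub>v\<close> over the out-neighbours \<open>v\<close> of \<open>i\<close>.
  Multilinearity expands the determinant into a sum over all choices of one out-neighbour per
  vertex, and each choice contributes \<open>1\<close> or \<open>0\<close>.
\<close>

lemma det_on_laplacian:
  assumes V: "finite V" "r \<in> V" and N: "\<And>u. u \<in> V - {r} \<Longrightarrow> N u \<subseteq> V"
  shows "det_on (V - {r}) (\<lambda>i j. (if i = j then int (card (N i)) else 0) - of_bool (j \<in> N i)) =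
    int (card {f \<in> Pi\<^sub>E (V - {r}) N. rooted V r f})"
    (is "det_on ?U ?L = _")
proof -
  let ?M = "\<lambda>f i j. of_bool (i = j) - of_bool (f i = j) :: int"
  have fin: "finite (N u)" if "u \<in> ?U" for u
    using N[OF that] V(1) by (rule finite_subset)
  have row: "?L i j = (\<Sum>v\<in>N i. of_bool (i = j) - of_bool (v = j))" if "i \<in> ?U" for i j
    using fin[OF that] by (simp add: sum_subtractf)
  have "det_on ?U ?L = (\<Sum>p | p permutes ?U. of_int (sign p) *
      (\<Prod>i\<in>?U. \<Sum>v\<in>N i. of_bool (i = p i) - of_bool (v = p i)))"
    unfolding det_on_def by (intro sum.cong prod.cong refl arg_cong2[where f = "(*)"] row)
  also have "\<dots> = (\<Sum>p | p permutes ?U. \<Sum>f\<in>Pi\<^sub>E ?U N. of_int (sign p) * (\<Prod>i\<in>?U. ?M f i (p i)))"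
    using V(1) fin by (intro sum.cong refl) (subst prod_sum_PiE, auto simp: sum_distrib_left)
  also have "\<dots> = (\<Sum>f\<in>Pi\<^sub>E ?U N. det_on ?U (?M f))"
    unfolding det_on_def by (rule sum.swap)
  also have "\<dots> = (\<Sum>f\<in>Pi\<^sub>E ?U N. of_bool (rooted V r f))"
    using N by (intro sum.cong refl det_on_rooted[OF V]) (auto simp: PiE_def Pi_def)
  also have "\<dots> = int (card {f \<in> Pi\<^sub>E ?U N. rooted V r f})"
  proof -
    have "finite (Pi\<^sub>E ?U N)" using V(1) fin by (intro finite_PiE) auto
    then show ?thesis by (simp add: sum_of_bool_eq Int_def)
  qed
  finally show ?thesis .
qed

lemma pcas_ends:
  "pcas u p v \<Longrightarrow> map fst p = butlast (u # map snd p) \<and> v = last (u # map snd p) \<and>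
    pawalk_verts u p = u # map snd p"
  by (induction p arbitrary: u) auto

lemma in_mk_symmetric:
  fixes H :: "'a pair_pre_digraph"
  shows "(x, y) \<in> parcs (mk_symmetric H) \<longleftrightarrow> (x, y) \<in> parcs H \<or> (y, x) \<in> parcs H"
  unfolding parcs_mk_symmetric with_proj_simps by fastforce

text \<open>
  Consecutive arcs of a closed walk share end points, also across its starting point, so a cycle
  is determined by the list of its heads.
\<close>

lemma cycle_vertices:
  assumes "pre_digraph.cycle (with_proj G) p"
  shows "distinct (map snd p)" "set p \<subseteq> parcs G"
    and "\<And>i. Suc i < length p \<Longrightarrow> p ! Suc i = (snd (p ! i), snd (p ! Suc i))"
    and "p ! 0 = (snd (p ! (length p - 1)), snd (p ! 0))"
proof -
  obtain u where u: "set p \<subseteq> parcs G" "pcas u p u" "p \<noteq> []" "distinct (tl (pawalk_verts u p))"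
    using assms by (auto simp: pre_digraph.cycle_def pre_digraph.awalk_def cas_with_proj_eq
      awalk_verts_with_proj_eq)
  have ends: "map fst p = butlast (u # map snd p)" "u = last (u # map snd p)"
    "pawalk_verts u p = u # map snd p"
    using pcas_ends[OF u(2)] by auto
  show "distinct (map snd p)" "set p \<subseteq> parcs G" using u ends(3) by auto
  have fst: "fst (p ! i) = (u # map snd p) ! i" if "i < length p" for i
    using arg_cong[OF ends(1), of "\<lambda>xs. xs ! i"] that
    by (simp add: nth_butlast del: butlast.simps)
  show "p ! Suc i = (snd (p ! i), snd (p ! Suc i))" if "Suc i < length p" for i
    using fst[OF that] that by (simp add: prod_eq_iff)
  show "p ! 0 = (snd (p ! (length p - 1)), snd (p ! 0))"
    using fst[of 0] ends(2) u(3) by (simp add: prod_eq_iff last_map last_conv_nth)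
qed

text \<open>
  At a vertex of an undirected cycle with maximal distance to the root, both cycle edges
  must be the unique outgoing arc, so its two neighbours on the cycle coincide.
\<close>

lemma rooted_no_cycle:
  fixes H :: "'a pair_pre_digraph"
  assumes H: "parcs H = fun_arcs (V - {r}) f" and rt: "rooted V r f"
    and f: "\<And>u. u \<in> V - {r} \<Longrightarrow> f u \<in> V"
    and cyc: "pre_digraph.cycle (mk_symmetric H) p"
  shows "length p < 3"
proof (rule ccontr)
  assume "\<not> length p < 3"
  then have len: "length p \<ge> 3" by simp
  obtain d :: "'a \<Rightarrow> nat" where d: "\<And>u. u \<in> V - {r} \<Longrightarrow> d (f u) < d u"
    using rooted_decreasing[OF rt f] by blast
  define w where "w i = snd (p ! i)" for i
  note c = cycle_vertices[OF cyc]
  have inj: "w i = w j \<longleftrightarrow> i = j" if "i < length p" "j < length p" for i j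
    using nth_eq_iff_index_eq[OF c(1), of i j] that by (simp add: w_def)
  define adj where "adj x y \<longleftrightarrow> (x, y) \<in> parcs (mk_symmetric H)" for x y
  have sym: "adj x y \<longleftrightarrow> adj y x" for x y
    by (auto simp: adj_def in_mk_symmetric)
  have adj_Suc: "adj (w i) (w (Suc i))" if "Suc i < length p" for i
    using c(2) c(3)[OF that] nth_mem[OF that] by (auto simp: adj_def w_def)
  have adj_0: "adj (w (length p - 1)) (w 0)"
  proof -
    have "p ! 0 \<in> parcs (mk_symmetric H)" using c(2) len by (intro subsetD[OF c(2)] nth_mem) auto
    then show ?thesis using c(4) by (simp add: adj_def w_def)
  qed
  have down: "y = f x" if "adj x y" "d y \<le> d x" for x y
  proof -
    have "y = f x \<or> (y \<in> V - {r} \<and> x = f y)"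
      using that(1) by (auto simp: adj_def in_mk_symmetric H)
    then show ?thesis using d[of y] that(2) by auto
  qed
  let ?S = "(\<lambda>i. d (w i)) ` {..<length p}"
  have "0 \<in> {..<length p}" using len by (cases p) auto
  then have "?S \<noteq> {}" by blast
  then have "Max ?S \<in> ?S" by (intro Max_in) auto
  then obtain i where "i < length p" "d (w i) = Max ?S" by auto
  then have i: "i < length p" "\<And>j. j < length p \<Longrightarrow> d (w j) \<le> d (w i)" by auto
  obtain j k where jk: "j < length p" "k < length p" "j \<noteq> k" "adj (w i) (w j)" "adj (w i) (w k)"
  proof -
    consider "i = 0" | "i = length p - 1" | "0 < i" "Suc i < length p" using i by linarith
    then show thesis
    proof cases
      case 1
      then show ?thesis using that[of "length p - 1" 1] adj_0 adj_Suc[of 0] sym len by auto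
    next
      case 2
      then have "Suc (length p - 2) = i" "length p - 2 < length p" "length p - 2 \<noteq> 0" "0 < length p"
        using len by linarith+
      then show ?thesis using that[of "length p - 2" 0] adj_0 adj_Suc[of "length p - 2"] sym i(1) 2
        by metis
    next
      case 3
      then show ?thesis using that[of "i - 1" "Suc i"] adj_Suc[of i] adj_Suc[of "i - 1"] sym by auto
    qed
  qed
  then have "w j = w k" using down i(2) by metis
  then show False using inj jk by simp
qed

text \<open>
  The set of vertices leading to \<open>r\<close> is closed under adjacency in both directions, because every
  vertex other than \<open>r\<close> has only one outgoing arc; so connectedness forces it to be everything.
\<close>

lemma rooted_connected:
  fixes H :: "'a pair_pre_digraph"
  assumes V: "pverts H = V" "r \<in> V" and H: "parcs H = fun_arcs (V - {r}) f"
    and f: "\<And>u. u \<in> V - {r} \<Longrightarrow> f u \<in> V"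
  shows "Digraph_Component.connected H \<longleftrightarrow> rooted V r f"
proof -
  define R where "R = rtrancl_on V (parcs (mk_symmetric H))"
  have sym: "(x, y) \<in> parcs (mk_symmetric H) \<longleftrightarrow> (y, x) \<in> parcs (mk_symmetric H)" for x y
    by (auto simp: in_mk_symmetric)
  have conn: "Digraph_Component.connected H \<longleftrightarrow> (\<forall>u\<in>V. \<forall>v\<in>V. (u, v) \<in> R)"
    using V by (auto simp: connected_def strongly_connected_def reachable_def R_def)
  show ?thesis
  proof
    assume "Digraph_Component.connected H"
    then have reach: "(r, u) \<in> R" if "u \<in> V" for u using conn V that by auto
    show "rooted V r f"
      unfolding rooted_def
    proof
      fix u assume "u \<in> V"
      from reach[OF this, unfolded R_def] show "(u, r) \<in> (fun_arcs (V - {r}) f)\<^sup>*"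
      proof (induction rule: rtrancl_on_induct)
        case (step y z)
        from step(2) consider "y \<in> V - {r}" "z = f y" | "z \<in> V - {r}" "y = f z"
          by (auto simp: in_mk_symmetric H)
        then show ?case
          using step.IH rtrancl_fun_arcs_step[of y V r f] rtrancl_fun_arcs_step[of z V r f] by cases auto
      qed simp
    qed
  next
    assume rt: "rooted V r f"
    have to: "(u, r) \<in> R \<and> (r, u) \<in> R" if "u \<in> V" for u
    proof -
      have "(u, r) \<in> (fun_arcs (V - {r}) f)\<^sup>*" using rt that by (auto simp: rooted_def)
      then show ?thesis
        using that
      proof (induction rule: converse_rtrancl_induct)
        case base
        then show ?case by (simp add: R_def)
      next
        case (step y z)
        then have z: "z = f y" "y \<in> V - {r}" "z \<in> V" using f by auto
        then have "(y, z) \<in> parcs (mk_symmetric H)" by (auto simp: in_mk_symmetric H)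
        then show ?case
          using step z sym unfolding R_def
          by (meson DiffD1 converse_rtrancl_on_into_rtrancl_on rtrancl_on_into_rtrancl_on)
      qed
    qed
    then show "Digraph_Component.connected H"
      unfolding conn R_def by (meson rtrancl_on_trans)
  qed
qed

lemma arborescences_eq_rooted:
  fixes D :: "'a pair_pre_digraph"
  assumes D: "pair_fin_digraph D" and r: "r \<in> pverts D"
  defines "N \<equiv> \<lambda>u. {v. (u, v) \<in> parcs D}"
  shows "{H. arborescence D r H} =
    (\<lambda>f. \<lparr>pverts = pverts D, parcs = fun_arcs (pverts D - {r}) f\<rparr>) `
      {f \<in> Pi\<^sub>E (pverts D - {r}) N. rooted (pverts D) r f}"
    (is "?A = ?H ` ?F")
proof (rule equalityI; rule subsetI)
  interpret D: pair_fin_digraph D by (rule D)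
  let ?V = "pverts D" and ?U = "pverts D - {r}"
  {
    fix H assume "H \<in> ?A"
    then have H: "spanning (with_proj H) (with_proj D)" "oriented_tree H"
      "out_degree H r = 0" "\<And>v. v \<in> ?U \<Longrightarrow> out_degree H v = 1"
      by (auto simp: arborescence_def)
    have VH: "pverts H = ?V" and sub: "parcs H \<subseteq> parcs D" and wf: "wf_digraph (with_proj H)"
      using H(1) by (auto simp: spanning_def subgraph_def)
    have EH: "fst e \<in> ?V" if "e \<in> parcs H" for e
      using wf_digraph.tail_in_verts[OF wf, of e] that VH by simp
    have "\<exists>v. out_arcs H u = {v}" if "u \<in> ?U" for u
      using H(4)[OF that] by (auto simp: out_degree_def card_1_singleton_iff)
    then obtain e where e: "\<And>u. u \<in> ?U \<Longrightarrow> out_arcs H u = {e u}" by metis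
    define f where "f = restrict (\<lambda>u. snd (e u)) ?U"
    have out: "out_arcs H u = {(u, f u)}" if "u \<in> ?U" for u
    proof -
      have "e u \<in> out_arcs H u" using e[OF that] by simp
      then have "fst (e u) = u" by (simp add: out_arcs_def)
      then show ?thesis using e[OF that] that by (simp add: f_def prod_eq_iff)
    qed
    have root: "e \<notin> parcs H" if "fst e = r" for e
    proof -
      have "out_arcs H r \<subseteq> parcs D" using sub by (auto simp: out_arcs_def)
      \<comment> \<open>An infinite set of arcs would also have cardinality \<open>0\<close>.\<close>
      then have "finite (out_arcs H r)" using D.pair_finite_arcs by (rule finite_subset)
      then have "out_arcs H r = {}" using H(3) by (simp add: out_degree_def)
      then show ?thesis using that unfolding out_arcs_def with_proj_simps by blast
    qed
    have PH: "parcs H = fun_arcs ?U f"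
    proof (rule Set.set_eqI)
      fix x :: "'a \<times> 'a"
      obtain u v where x: "x = (u, v)" by (cases x)
      show "x \<in> parcs H \<longleftrightarrow> x \<in> fun_arcs ?U f"
      proof (cases "u \<in> ?U")
        case True
        have "x \<in> parcs H \<longleftrightarrow> x \<in> out_arcs H u" by (simp add: out_arcs_def x)
        then show ?thesis using out[OF True] True by (simp add: x)
      next
        case False
        then have "x \<notin> parcs H" using EH[of x] root[of x] x by auto
        then show ?thesis using False by (simp add: x)
      qed
    qed
    have f: "f \<in> Pi\<^sub>E ?U N"
    proof (rule PiE_I)
      fix u assume "u \<in> ?U"
      then have "(u, f u) \<in> parcs H" by (simp add: PH)
      then show "f u \<in> N u" using sub by (auto simp: N_def)
    qed (auto simp: f_def)
    then have "f u \<in> ?V" if "u \<in> ?U" for u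
      using that D.in_arcsD2 by (auto simp: N_def PiE_def Pi_def)
    then have "rooted ?V r f"
      using rooted_connected[OF VH r PH] H(2) by (auto simp: oriented_tree_def)
    moreover have "H = ?H f" by (rule pair_pre_digraph.equality) (simp_all add: VH PH)
    ultimately show "H \<in> ?H ` ?F" using f by blast
  }
  {
    fix H assume "H \<in> ?H ` ?F"
    then obtain f where f: "f \<in> Pi\<^sub>E ?U N" and rt: "rooted ?V r f" and Hf: "H = ?H f" by blast
    then have VH: "pverts H = ?V" and PH: "parcs H = fun_arcs ?U f" by simp_all
    have fN: "(u, f u) \<in> parcs D" if "u \<in> ?U" for u
      using f that by (auto simp: N_def PiE_def Pi_def)
    then have fV: "f u \<in> ?V" if "u \<in> ?U" for u using that D.in_arcsD2 by blast
    have wfH: "wf_digraph (with_proj H)"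
      using fV by unfold_locales (force simp: VH PH fun_arcs_def)+
    have "spanning H D"
      using wfH D.wf_digraph_axioms fN
      by (auto simp: spanning_def subgraph_def compatible_def VH PH)
    moreover have "out_arcs H r = {}" by (auto simp: out_arcs_def PH)
    moreover have "out_arcs H v = {(v, f v)}" if "v \<in> ?U" for v
      using that by (auto simp: out_arcs_def PH)
    moreover have "Digraph_Component.connected H"
      using rooted_connected[OF VH r PH] fV rt by blast
    moreover have "asym (parcs H)"
    proof -
      obtain d :: "'a \<Rightarrow> nat" where d: "\<And>u. u \<in> ?U \<Longrightarrow> d (f u) < d u"
        using rooted_decreasing[OF rt fV] by blast
      have "(v, u) \<notin> parcs H" if "(u, v) \<in> parcs H" for u v
        using that d[of u] d[of v] by (auto simp: PH)
      then show ?thesis by (auto intro!: asymI)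
    qed
    moreover have "length p < 3" if "pre_digraph.cycle (mk_symmetric H) p" for p
      using rooted_no_cycle[OF PH rt fV that] by blast
    ultimately show "H \<in> ?A"
      using r by (fastforce simp: arborescence_def oriented_tree_def out_degree_def)
  }
qed

text \<open>
  The matrix-tree theorem: arborescences correspond to the functions counted by
  \<open>det_on_laplacian\<close>.
\<close>

theorem arb_at_eq_det:
  fixes D :: "'a pair_pre_digraph"
  assumes "pair_fin_digraph D" and r: "r \<in> pverts D"
  shows "int (arb_at D r) = det_on (pverts D - {r})
    (\<lambda>i j. (if i = j then int (out_degree D i) else 0) - of_bool ((i, j) \<in> parcs D))"
proof -
  interpret D: pair_fin_digraph D by fact
  let ?U = "pverts D - {r}" and ?N = "\<lambda>u. {v. (u, v) \<in> parcs D}"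
  let ?F = "{f \<in> Pi\<^sub>E ?U ?N. rooted (pverts D) r f}"
  have deg: "out_degree D u = card (?N u)" for u
  proof -
    have "out_arcs D u = Pair u ` ?N u" by (auto simp: out_arcs_def)
    then show ?thesis by (simp add: out_degree_def card_image inj_on_def)
  qed
  have "inj_on (\<lambda>f. \<lparr>pverts = pverts D, parcs = fun_arcs ?U f\<rparr>) ?F"
  proof (rule inj_onI)
    fix f g assume fg: "f \<in> ?F" "g \<in> ?F"
      "\<lparr>pverts = pverts D, parcs = fun_arcs ?U f\<rparr> = \<lparr>pverts = pverts D, parcs = fun_arcs ?U g\<rparr>"
    have "f u = g u" if "u \<in> ?U" for u
    proof -
      have "(u, f u) \<in> fun_arcs ?U g" using fg(3) that by (metis in_fun_arcs pair_pre_digraph.select_convs(2))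
      then show ?thesis by simp
    qed
    then show "f = g" using fg(1,2) by (auto intro: PiE_ext)
  qed
  then have "arb_at D r = card ?F"
    unfolding arb_at_def arborescences_eq_rooted[OF assms]
    by (rule card_image)
  moreover have "det_on ?U (\<lambda>i j. (if i = j then int (card (?N i)) else 0) - of_bool (j \<in> ?N i)) =
      int (card ?F)"
    using D.pair_finite_verts r by (intro det_on_laplacian) (auto dest: D.in_arcsD2)
  ultimately show ?thesis unfolding deg by simp
qed

section \<open>The skew adjacency matrix of an Eulerian tournament\<close>

text \<open>
  The sign is chosen such that twice the Laplacian of an Eulerian tournament is obtained by adding,
  not subtracting, this matrix.
\<close>

definition skew_adjacency :: "'a rel \<Rightarrow> 'a \<Rightarrow> 'a \<Rightarrow> int" where
  "skew_adjacency E u v = of_bool ((v, u) \<in> E) - of_bool ((u, v) \<in> E)"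

lemma skew_adjacency_skew: "skew_adjacency E u v = - skew_adjacency E v u"
  by (simp add: skew_adjacency_def)

lemma tournament_arc_iff:
  assumes "tournament T" "u \<in> pverts T" "v \<in> pverts T"
  shows "(u, v) \<in> parcs T \<longleftrightarrow> u \<noteq> v \<and> (v, u) \<notin> parcs T"
proof -
  interpret pair_digraph T using assms(1) by (simp add: tournament_def)
  show ?thesis
  proof (cases "u = v")
    case True
    then show ?thesis using pair_no_loops[of "(v, v)"] by auto
  next
    case False
    then have "(u, v) \<in> parcs T \<longleftrightarrow> (v, u) \<notin> parcs T"
      using assms unfolding tournament_def by blast
    then show ?thesis using False by blast
  qed
qed

lemma skew_adjacency_tournament:
  assumes "tournament T" "u \<in> pverts T" "v \<in> pverts T"
  shows "skew_adjacency (parcs T) u v =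
    (if u = v then 0 else if (u, v) \<in> parcs T then - 1 else 1)"
proof (cases "u = v")
  case True
  then show ?thesis by (simp add: skew_adjacency_def)
next
  case False
  then have "(v, u) \<in> parcs T \<longleftrightarrow> (u, v) \<notin> parcs T"
    using tournament_arc_iff[OF assms] by blast
  then show ?thesis using False by (simp add: skew_adjacency_def)
qed

lemma odd_skew_adjacency:
  assumes "tournament T" "u \<in> pverts T" "v \<in> pverts T"
  shows "odd (skew_adjacency (parcs T) u v) \<longleftrightarrow> u \<noteq> v"
  by (simp add: skew_adjacency_tournament[OF assms])

lemma eulerian_tournament_degrees:
  assumes T: "tournament T" "eulerian T" and u: "u \<in> pverts T"
  shows "2 * out_degree T u + 1 = card (pverts T)"
    and "(\<Sum>v\<in>pverts T. skew_adjacency (parcs T) u v) = 0"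
proof -
  interpret pair_digraph T using T(1) by (simp add: tournament_def)
  let ?V = "pverts T"
  let ?O = "{v \<in> ?V. (u, v) \<in> parcs T}" and ?I = "{v \<in> ?V. (v, u) \<in> parcs T}"
  have "out_arcs T u = Pair u ` ?O" by (auto simp: out_arcs_def dest: in_arcsD2)
  then have out: "out_degree T u = card ?O" by (simp add: out_degree_def card_image inj_on_def)
  have "in_arcs T u = (\<lambda>v. (v, u)) ` ?I" by (auto simp: in_arcs_def dest: in_arcsD1)
  then have "in_degree T u = card ?I" by (simp add: in_degree_def card_image inj_on_def)
  then have eq: "card ?I = card ?O" using T(2) u out by (simp add: eulerian_def)
  have fin: "finite ?V" by (rule pair_finite_verts)
  have "(u, u) \<notin> parcs T" using pair_no_loops[of "(u, u)"] by auto
  then have "u \<notin> ?O \<union> ?I" by simp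
  moreover have "card (?O \<union> ?I) = card ?O + card ?I"
    using fin tournament_arc_iff[OF T(1) u] by (intro card_Un_disjoint) (simp, simp, blast)
  ultimately have "card (insert u (?O \<union> ?I)) = Suc (card ?O + card ?I)"
    using fin by (subst card_insert_disjoint) simp_all
  moreover have "?V = insert u (?O \<union> ?I)" using tournament_arc_iff[OF T(1) u] u by blast
  ultimately have "card ?V = Suc (card ?O + card ?I)" by (rule trans[OF arg_cong[where f = card], rotated])
  then show "2 * out_degree T u + 1 = card ?V" using eq out by simp
  have "(\<Sum>v\<in>?V. skew_adjacency (parcs T) u v) = int (card ?I) - int (card ?O)"
    using fin by (simp add: skew_adjacency_def sum_subtractf Int_def)
  then show "(\<Sum>v\<in>?V. skew_adjacency (parcs T) u v) = 0" using eq by simp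
qed

text \<open>
  The matrix on the left has all line sums \<open>n\<close>; deleting \<open>r\<close> and subtracting \<open>1\<close> from every entry turns it
  into twice the reduced Laplacian. Since \<open>r\<close> does not occur on the left, the number of
  arborescences is the same for all roots.
\<close>

lemma arb_at_eulerian_tournament:
  fixes T :: "'a pair_pre_digraph"
  assumes T: "tournament T" "eulerian T" and r: "r \<in> pverts T"
  defines "n \<equiv> card (pverts T)"
  shows "det_on (pverts T) (\<lambda>i j. (if i = j then real n else 0) + real_of_int (skew_adjacency (parcs T) i j))
    = (real n)\<^sup>2 * 2 ^ (n - 1) * real (arb_at T r)"
proof -
  interpret pair_digraph T using T(1) by (simp add: tournament_def)
  let ?V = "pverts T" and ?W = "skew_adjacency (parcs T)"
  let ?M = "\<lambda>i j. (if i = j then real n else 0) + real_of_int (?W i j)"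
  let ?L = "\<lambda>i j. (if i = j then int (out_degree T i) else 0) - of_bool ((i, j) \<in> parcs T)"
  have V: "finite ?V" by (rule pair_finite_verts)
  then have n: "n > 0" using r by (auto simp: n_def card_gt_0_iff)
  have row: "(\<Sum>j\<in>?V. ?M i j) = n" if "i \<in> ?V" for i
    using eulerian_tournament_degrees(2)[OF T that] V that
    by (simp add: sum.distrib flip: of_int_sum)
  have col: "(\<Sum>i\<in>?V. ?M i j) = n" if "j \<in> ?V" for j
  proof -
    have "(\<Sum>i\<in>?V. ?W i j) = - (\<Sum>i\<in>?V. ?W j i)"
      by (subst skew_adjacency_skew) (simp add: sum_negf)
    then show ?thesis
      using eulerian_tournament_degrees(2)[OF T that] V that
      by (simp add: sum.distrib flip: of_int_sum)
  qed
  have "det_on ?V ?M = real n * real n * det_on (?V - {r}) (\<lambda>i j. ?M i j - real n / real n)"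
    using det_on_constant_line_sums[OF V r, of ?M "real n"] row col by (simp only: n_def)
  also have "det_on (?V - {r}) (\<lambda>i j. ?M i j - real n / real n) =
      det_on (?V - {r}) (\<lambda>i j. 2 * real_of_int (?L i j) * 1)"
  proof (rule det_on_cong)
    fix i j assume "i \<in> ?V - {r}" "j \<in> ?V - {r}"
    then have ij: "i \<in> ?V" "j \<in> ?V" by auto
    have "real n = 2 * real (out_degree T i) + 1"
      using eulerian_tournament_degrees(1)[OF T ij(1)] by (simp add: n_def flip: of_nat_eq_iff[where ?'a = real])
    then show "?M i j - real n / real n = 2 * real_of_int (?L i j) * 1"
      using n pair_no_loops[of "(i, i)"] by (auto simp: skew_adjacency_tournament[OF T(1) ij])
  qed
  also have "\<dots> = 2 ^ (n - 1) * real_of_int (det_on (?V - {r}) ?L)"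
    using V r by (subst det_on_scale) (auto simp: n_def of_int_det_on)
  also have "det_on (?V - {r}) ?L = int (arb_at T r)"
    by (rule arb_at_eq_det[OF pair_fin_digraph_axioms r, symmetric])
  finally show ?thesis by (simp add: power2_eq_square)
qed

section \<open>Tournaments all of whose principal minors are extremal\<close>

text \<open>
  The arcs of the model tournament on \<open>{..<n}\<close> that arises from the linear order by switching
  the vertices of odd rank, that is, by reversing all arcs between ranks of different parity,
  and then reversing every arc.
\<close>

definition alternating_arc :: "nat \<Rightarrow> nat \<Rightarrow> bool" where
  "alternating_arc a b \<longleftrightarrow> a \<noteq> b \<and> (a < b \<longleftrightarrow> odd (a + b))"

definition alternating_order :: "'a pair_pre_digraph \<Rightarrow> ('a \<Rightarrow> nat) \<Rightarrow> bool" where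
  "alternating_order T p \<longleftrightarrow> bij_betw p (pverts T) {..<card (pverts T)} \<and>
    (\<forall>u\<in>pverts T. \<forall>v\<in>pverts T. (u, v) \<in> parcs T \<longleftrightarrow> alternating_arc (p u) (p v))"

lemma alternating_order_iff:
  assumes T: "tournament T"
  shows "alternating_order T p \<longleftrightarrow> bij_betw p (pverts T) {..<card (pverts T)} \<and>
    (\<forall>u\<in>pverts T. \<forall>v\<in>pverts T.
       skew_adjacency (parcs T) u v = (- 1) ^ (p u + p v) * order_sign p u v)"
proof -
  have "((u, v) \<in> parcs T \<longleftrightarrow> alternating_arc (p u) (p v)) \<longleftrightarrow>
      skew_adjacency (parcs T) u v = (- 1) ^ (p u + p v) * order_sign p u v"
    if inj: "inj_on p (pverts T)" and uv: "u \<in> pverts T" "v \<in> pverts T" for u v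
  proof -
    have "p u = p v \<longleftrightarrow> u = v" using inj uv by (auto dest: inj_onD)
    moreover have "(v, v) \<notin> parcs T" using tournament_arc_iff[OF T uv(2) uv(2)] by blast
    ultimately show ?thesis
      by (auto simp: skew_adjacency_tournament[OF T uv] alternating_arc_def order_sign_def
          minus_one_power_iff)
  qed
  then show ?thesis unfolding alternating_order_def by (auto simp: bij_betw_def)
qed

text \<open>
  Conjugating by the signs \<open>(- 1) ^ p i\<close> turns the matrix into that of a linear order.
\<close>

lemma alternating_order_minors:
  assumes "tournament T" "alternating_order T p" "I \<subseteq> pverts T"
  shows "det_on I (skew_adjacency (parcs T)) = of_bool (even (card I))"
proof -
  interpret pair_digraph T using assms(1) by (simp add: tournament_def)
  have I: "finite I" using assms(3) pair_finite_verts by (rule finite_subset)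
  have p: "inj_on p I" using assms by (auto simp: alternating_order_def bij_betw_def intro: inj_on_subset)
  have "det_on I (skew_adjacency (parcs T)) =
      det_on I (\<lambda>i j. (- 1) ^ p i * order_sign p i j * (- 1) ^ p j)"
  proof (rule det_on_cong)
    fix i j assume "i \<in> I" "j \<in> I"
    then have "skew_adjacency (parcs T) i j = (- 1) ^ (p i + p j) * order_sign p i j"
      using assms by (simp add: alternating_order_iff subset_eq)
    then show "skew_adjacency (parcs T) i j = (- 1) ^ p i * order_sign p i j * (- 1) ^ p j"
      by (simp add: power_add)
  qed
  also have "\<dots> = (\<Prod>i\<in>I. (- 1) ^ p i * (- 1) ^ p i) * det_on I (order_sign p)"
    by (simp only: det_on_scale[OF I] prod.distrib)
  also have "(\<Prod>i\<in>I. (- 1) ^ p i * (- 1) ^ p i :: int) = 1"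
    by (intro prod.neutral) (simp add: minus_one_power_iff)
  finally show ?thesis by (simp add: det_on_order_sign[OF I p])
qed

text \<open>
  A failure of transitivity is a cyclic triangle. It cannot contain \<open>r\<close>, which has no incoming arc, so
  \<open>r\<close> dominates it and the resulting minor is \<open>9\<close>.
\<close>

lemma dominating_vertex_transitive:
  fixes W :: "'a \<Rightarrow> 'a \<Rightarrow> int"
  assumes r: "r \<in> V" and skew: "\<And>i j. i \<in> V \<Longrightarrow> j \<in> V \<Longrightarrow> W i j = - W j i"
    and unit: "\<And>i j. i \<in> V \<Longrightarrow> j \<in> V \<Longrightarrow> i \<noteq> j \<Longrightarrow> W i j = 1 \<or> W i j = - 1"
    and dom: "\<And>v. v \<in> V \<Longrightarrow> v \<noteq> r \<Longrightarrow> W r v = 1"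
    and minor: "\<And>I. I \<subseteq> V \<Longrightarrow> card I = 4 \<Longrightarrow> det_on I W = 1"
    and abc: "a \<in> V" "b \<in> V" "c \<in> V" "W a b = 1" "W b c = 1"
  shows "W a c = 1"
proof (rule ccontr)
  assume ac: "W a c \<noteq> 1"
  have diag: "W i i = 0" if "i \<in> V" for i using skew[OF that that] by simp
  have ne: "a \<noteq> b" "b \<noteq> c" "a \<noteq> c"
    using abc diag skew[of a b] by auto
  have into_r: "W i r \<noteq> 1" if "i \<in> V" for i
    using that r skew[of i r] dom[of i] diag[of r] by (cases "i = r") auto
  have "b \<noteq> r" "c \<noteq> r" using into_r abc by auto
  moreover have "a \<noteq> r" using ac dom abc(3) ne by auto
  ultimately have "det_on {r, a, b, c} W = 9"
  proof (intro det_on_dominated_cycle)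
    show "W c a = 1" using ac unit[of a c] skew[of c a] ne abc by auto
    show "W i j = - W j i" if "i \<in> {r, a, b, c}" "j \<in> {r, a, b, c}" for i j
      using that r abc(1-3) by (intro skew) auto
  qed (use ne abc dom in auto)
  moreover have "det_on {r, a, b, c} W = 1"
    using r abc(1-3) ne \<open>a \<noteq> r\<close> \<open>b \<noteq> r\<close> \<open>c \<noteq> r\<close> by (intro minor) auto
  ultimately show False by simp
qed

text \<open>
  The rank of a vertex is the number of its predecessors.
\<close>

lemma transitive_sign_matrix_order:
  fixes W :: "'a \<Rightarrow> 'a \<Rightarrow> int"
  assumes V: "finite V" and skew: "\<And>i j. i \<in> V \<Longrightarrow> j \<in> V \<Longrightarrow> W i j = - W j i"
    and unit: "\<And>i j. i \<in> V \<Longrightarrow> j \<in> V \<Longrightarrow> i \<noteq> j \<Longrightarrow> W i j = 1 \<or> W i j = - 1"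
    and trans: "\<And>a b c. a \<in> V \<Longrightarrow> b \<in> V \<Longrightarrow> c \<in> V \<Longrightarrow> W a b = 1 \<Longrightarrow> W b c = 1 \<Longrightarrow> W a c = 1"
  shows "\<exists>p. bij_betw p V {..<card V} \<and> (\<forall>i\<in>V. \<forall>j\<in>V. W i j = order_sign p i j)"
proof -
  define p where "p u = card {v \<in> V. W v u = 1}" for u
  have diag: "W i i = 0" if "i \<in> V" for i using skew[OF that that] by simp
  have mono: "p u < p v" if uv: "u \<in> V" "v \<in> V" "W u v = 1" for u v
  proof -
    have "{w \<in> V. W w u = 1} \<subset> {w \<in> V. W w v = 1}"
    proof (rule psubsetI)
      show "{w \<in> V. W w u = 1} \<subseteq> {w \<in> V. W w v = 1}"
        using uv trans by blast
      have "u \<in> {w \<in> V. W w v = 1}" "u \<notin> {w \<in> V. W w u = 1}" using uv diag by auto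
      then show "{w \<in> V. W w u = 1} \<noteq> {w \<in> V. W w v = 1}" by blast
    qed
    then show ?thesis unfolding p_def using V by (intro psubset_card_mono) auto
  qed
  have ordered: "W u v = 1 \<and> p u < p v \<or> W u v = - 1 \<and> p v < p u"
    if "u \<in> V" "v \<in> V" "u \<noteq> v" for u v
    using unit[OF that] mono[of u v] mono[of v u] skew[of v u] that by auto
  have "W i j = order_sign p i j" if "i \<in> V" "j \<in> V" for i j
    using ordered[OF that] diag[OF that(1)] by (cases "i = j") (auto simp: order_sign_def)
  moreover have "inj_on p V" using ordered by (intro inj_onI) fastforce
  moreover have "p ` V \<subseteq> {..<card V}"
  proof
    fix k assume "k \<in> p ` V"
    then obtain u where u: "u \<in> V" "k = p u" by blast
    then have "u \<notin> {v \<in> V. W v u = 1}" using diag by simp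
    then have "{v \<in> V. W v u = 1} \<subset> V" using u(1) by blast
    then show "k \<in> {..<card V}" using V u by (auto simp: p_def intro: psubset_card_mono)
  qed
  ultimately show ?thesis
    by (intro exI[of _ p]) (simp add: bij_betw_def card_image card_subset_eq)
qed

text \<open>
  Moving the dividing point from \<open>k\<close> to \<open>k + 1\<close> changes the difference between the right and the left
  sum by \<open>e k + e (k + 1)\<close>, and both differences vanish.
\<close>

lemma balanced_signs_alternate:
  fixes e :: "nat \<Rightarrow> int"
  assumes bal: "\<And>k. k < n \<Longrightarrow> (\<Sum>j<n. e j * order_sign id k j) = 0" and k: "k < n"
  shows "e k = (- 1) ^ k * e 0"
  using k
proof (induction k)
  case (Suc k)
  have "0 = (\<Sum>j<n. e j * order_sign id k j) - (\<Sum>j<n. e j * order_sign id (Suc k) j)"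
    using bal[of k] bal[of "Suc k"] Suc.prems by simp
  also have "\<dots> = (\<Sum>j<n. (if j = k then e j else 0) + (if j = Suc k then e j else 0))"
    unfolding sum_subtractf[symmetric] by (intro sum.cong) (auto simp: order_sign_def)
  also have "\<dots> = e k + e (Suc k)"
    using Suc.prems by (simp add: sum.distrib)
  finally show ?case using Suc by simp
qed simp

text \<open>
  Switching by \<open>\<epsilon>\<close> makes \<open>r\<close> dominate all other vertices without changing the minors, so the switched
  matrix \<open>W\<close> is that of a linear order. The balance condition at each vertex, read along this
  order, then determines \<open>\<epsilon>\<close> up to a global sign.
\<close>

lemma extremal_minors_alternating_order:
  assumes T: "tournament T" "eulerian T" and ne: "pverts T \<noteq> {}"
    and minor: "\<And>I. I \<subseteq> pverts T \<Longrightarrow> det_on I (skew_adjacency (parcs T)) = of_bool (even (card I))"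
  shows "\<exists>p. alternating_order T p"
proof -
  interpret pair_digraph T using T(1) by (simp add: tournament_def)
  let ?V = "pverts T" and ?W = "skew_adjacency (parcs T)" and ?n = "card (pverts T)"
  have V: "finite ?V" by (rule pair_finite_verts)
  obtain r where r: "r \<in> ?V" using ne by blast
  \<comment> \<open>The signs of row \<open>r\<close>: switching by them makes that row constantly \<open>1\<close> off the diagonal.\<close>
  define \<epsilon> where "\<epsilon> u = (if u = r then 1 else ?W r u)" for u
  define W where "W u v = \<epsilon> u * ?W u v * \<epsilon> v" for u v
  have unitW: "?W u v = 1 \<or> ?W u v = - 1" if "u \<in> ?V" "v \<in> ?V" "u \<noteq> v" for u v
    using skew_adjacency_tournament[OF T(1) that(1,2)] that(3) by auto
  have unit: "\<epsilon> u = 1 \<or> \<epsilon> u = - 1" if "u \<in> ?V" for u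
    using unitW[OF r that] by (auto simp: \<epsilon>_def)
  then have sq: "\<epsilon> u * \<epsilon> u = 1" if "u \<in> ?V" for u using that by fastforce
  have skew: "W u v = - W v u" for u v
    using skew_adjacency_skew[of "parcs T" u v] by (simp add: W_def)
  have unit': "W u v = 1 \<or> W u v = - 1" if "u \<in> ?V" "v \<in> ?V" "u \<noteq> v" for u v
    using unit[OF that(1)] unit[OF that(2)] unitW[OF that] by (auto simp: W_def)
  have dom: "W r v = 1" if "v \<in> ?V" "v \<noteq> r" for v
    using unitW[OF r that(1)] that(2) by (auto simp: W_def \<epsilon>_def)
  have minor': "det_on I W = 1" if I: "I \<subseteq> ?V" "card I = 4" for I
  proof -
    have "det_on I W = (\<Prod>i\<in>I. \<epsilon> i * \<epsilon> i) * det_on I ?W"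
      unfolding W_def using I V by (subst det_on_scale) (auto simp: prod.distrib intro: finite_subset)
    also have "(\<Prod>i\<in>I. \<epsilon> i * \<epsilon> i) = 1" using I sq by (intro prod.neutral) auto
    finally show ?thesis using minor[OF I(1)] I(2) by simp
  qed
  have trans: "W a c = 1" if "a \<in> ?V" "b \<in> ?V" "c \<in> ?V" "W a b = 1" "W b c = 1" for a b c
    by (rule dominating_vertex_transitive[OF r skew unit' dom minor' that])
  have "\<exists>p. bij_betw p ?V {..<?n} \<and> (\<forall>u\<in>?V. \<forall>v\<in>?V. W u v = order_sign p u v)"
    by (rule transitive_sign_matrix_order[OF V skew unit' trans])
  then obtain p where p: "bij_betw p ?V {..<?n}"
    and Wp: "\<And>u v. u \<in> ?V \<Longrightarrow> v \<in> ?V \<Longrightarrow> W u v = order_sign p u v"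
    by blast
  define q where "q = inv_into ?V p"
  have q: "bij_betw q {..<?n} ?V" unfolding q_def by (rule bij_betw_inv_into[OF p])
  have pq: "p (q k) = k" if "k < ?n" for k
    using p that by (simp add: q_def bij_betw_inv_into_right)
  have qp: "q (p u) = u" if "u \<in> ?V" for u
    using p that by (simp add: q_def bij_betw_inv_into_left)
  have WW: "?W u v = \<epsilon> u * \<epsilon> v * order_sign p u v" if "u \<in> ?V" "v \<in> ?V" for u v
    using unit[OF that(1)] unit[OF that(2)] Wp[OF that] by (auto simp: W_def)
  have "(\<Sum>j<?n. \<epsilon> (q j) * order_sign id k j) = 0" if k: "k < ?n" for k
  proof -
    have qk: "q k \<in> ?V" using bij_betwE[OF q] k by simp
    have "0 = \<epsilon> (q k) * (\<Sum>v\<in>?V. ?W (q k) v)"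
      using eulerian_tournament_degrees(2)[OF T qk] by simp
    also have "\<dots> = (\<Sum>v\<in>?V. \<epsilon> v * order_sign p (q k) v)"
      unfolding sum_distrib_left
    proof (intro sum.cong refl)
      fix v assume "v \<in> ?V"
      then show "\<epsilon> (q k) * ?W (q k) v = \<epsilon> v * order_sign p (q k) v"
        using WW[OF qk] sq[OF qk] by (simp flip: mult.assoc)
    qed
    also have "\<dots> = (\<Sum>j<?n. \<epsilon> (q j) * order_sign p (q k) (q j))"
      by (rule sum.reindex_bij_betw[OF q, symmetric])
    also have "\<dots> = (\<Sum>j<?n. \<epsilon> (q j) * order_sign id k j)"
      using k by (intro sum.cong) (simp_all add: order_sign_def pq)
    finally show ?thesis by simp
  qed
  then have alt: "\<epsilon> (q k) = (- 1) ^ k * \<epsilon> (q 0)" if "k < ?n" for k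
    using that by (rule balanced_signs_alternate)
  have "\<epsilon> u = (- 1) ^ p u * \<epsilon> (q 0)" if "u \<in> ?V" for u
    using alt[of "p u"] bij_betwE[OF p] qp that by auto
  moreover have "\<epsilon> (q 0) * \<epsilon> (q 0) = 1"
    using sq bij_betwE[OF q] ne V by (simp add: card_gt_0_iff)
  ultimately have "?W u v = (- 1) ^ (p u + p v) * order_sign p u v" if "u \<in> ?V" "v \<in> ?V" for u v
    using WW[OF that] that by (simp add: power_add algebra_simps)
  then have "alternating_order T p" using p by (simp add: alternating_order_iff[OF T(1)])
  then show ?thesis by (rule exI[of _ p])
qed

section \<open>The swirl tournament\<close>

text \<open>
  An isomorphism is a record of maps for vertices, arcs, heads and tails; for digraphs whose arcs
  are pairs all of them are determined by the map on vertices.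
\<close>

lemma digraph_iso_pair_iff:
  fixes T :: "'a pair_pre_digraph" and S :: "'b pair_pre_digraph"
  assumes T: "pair_wf_digraph T" and S: "pair_wf_digraph S"
  shows "digraph_iso T S \<longleftrightarrow> (\<exists>f. bij_betw f (pverts T) (pverts S) \<and>
    (\<forall>u\<in>pverts T. \<forall>v\<in>pverts T. (u, v) \<in> parcs T \<longleftrightarrow> (f u, f v) \<in> parcs S))"
proof
  interpret T: pair_wf_digraph T by (rule T)
  interpret S: pair_wf_digraph S by (rule S)
  {
    assume "digraph_iso T S"
    then obtain h where h: "pre_digraph.digraph_isomorphism (with_proj T) h"
      and S: "with_proj S = app_iso h (with_proj T)"
      by (auto simp: digraph_iso_def)
    let ?f = "iso_verts h"
    have tail: "iso_tail h = fst" and head: "iso_head h = snd"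
      and V: "pverts S = ?f ` pverts T" and E: "parcs S = iso_arcs h ` parcs T"
      using arg_cong[OF S, of tail] arg_cong[OF S, of head] arg_cong[OF S, of verts]
        arg_cong[OF S, of arcs] by simp_all
    have inj: "inj_on ?f (pverts T)"
      and arc: "\<And>e. e \<in> parcs T \<Longrightarrow> iso_arcs h e = (?f (fst e), ?f (snd e))"
      using h by (auto simp: pre_digraph.digraph_isomorphism_def tail head prod_eq_iff)
    have E': "parcs S = (\<lambda>e. (?f (fst e), ?f (snd e))) ` parcs T"
      unfolding E using arc by (intro image_cong) auto
    have "(u, v) \<in> parcs T \<longleftrightarrow> (?f u, ?f v) \<in> parcs S" if "u \<in> pverts T" "v \<in> pverts T" for u v
    proof
      assume "(?f u, ?f v) \<in> parcs S"
      then obtain a b where "(a, b) \<in> parcs T" "?f u = ?f a" "?f v = ?f b"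
        unfolding E' by auto
      then show "(u, v) \<in> parcs T"
        using inj that T.in_arcsD1 T.in_arcsD2 by (metis inj_onD)
    qed (force simp: E')
    then show "\<exists>f. bij_betw f (pverts T) (pverts S) \<and>
      (\<forall>u\<in>pverts T. \<forall>v\<in>pverts T. (u, v) \<in> parcs T \<longleftrightarrow> (f u, f v) \<in> parcs S)"
      using inj V by (intro exI[of _ ?f]) (auto simp: bij_betw_def)
  }
  {
    assume "\<exists>f. bij_betw f (pverts T) (pverts S) \<and>
      (\<forall>u\<in>pverts T. \<forall>v\<in>pverts T. (u, v) \<in> parcs T \<longleftrightarrow> (f u, f v) \<in> parcs S)"
    then obtain f where f: "inj_on f (pverts T)" "f ` pverts T = pverts S"
      and E: "\<And>u v. u \<in> pverts T \<Longrightarrow> v \<in> pverts T \<Longrightarrow> (u, v) \<in> parcs T \<longleftrightarrow> (f u, f v) \<in> parcs S"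
      by (auto simp: bij_betw_def)
    define h :: "('a, 'a \<times> 'a, 'b, 'b \<times> 'b) digraph_isomorphism"
      where "h = \<lparr>iso_verts = f, iso_arcs = map_prod f f, iso_head = snd, iso_tail = fst\<rparr>"
    have "inj_on (map_prod f f) (parcs T)"
      using map_prod_inj_on[OF f(1) f(1)] by (rule inj_on_subset) (auto dest: T.in_arcsD1 T.in_arcsD2)
    then have "pre_digraph.digraph_isomorphism (with_proj T) h"
      using f T.wf_digraph_axioms by (auto simp: pre_digraph.digraph_isomorphism_def h_def)
    moreover have "map_prod f f ` parcs T = parcs S"
    proof (rule equalityI; rule subsetI)
      fix x assume "x \<in> map_prod f f ` parcs T"
      then show "x \<in> parcs S" using E by (auto dest: T.in_arcsD1 T.in_arcsD2)
    next
      fix x assume x: "x \<in> parcs S"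
      then have "fst x \<in> f ` pverts T" "snd x \<in> f ` pverts T"
        using S.arc_fst_in_verts S.arc_snd_in_verts f(2) by auto
      then obtain u v where "u \<in> pverts T" "v \<in> pverts T" "x = (f u, f v)"
        by (auto simp: prod_eq_iff)
      then show "x \<in> map_prod f f ` parcs T" using x E by (auto intro!: image_eqI[of _ _ "(u, v)"])
    qed
    then have "with_proj S = app_iso h (with_proj T)"
      using f(2) by (simp add: app_iso_def h_def with_proj_def)
    ultimately show "digraph_iso T S" by (auto simp: digraph_iso_def)
  }
qed

lemma alternating_order_iso_iff:
  fixes T :: "'a pair_pre_digraph" and S :: "'b pair_pre_digraph"
  assumes T: "pair_wf_digraph T" and S: "pair_wf_digraph S"
    and q: "alternating_order S q" and card: "card (pverts T) = card (pverts S)"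
  shows "digraph_iso T S \<longleftrightarrow> (\<exists>p. alternating_order T p)"
proof
  let ?n = "card (pverts S)"
  have q': "bij_betw q (pverts S) {..<?n}"
    and qE: "\<And>u v. u \<in> pverts S \<Longrightarrow> v \<in> pverts S \<Longrightarrow> (u, v) \<in> parcs S \<longleftrightarrow> alternating_arc (q u) (q v)"
    using q by (auto simp: alternating_order_def)
  {
    assume "digraph_iso T S"
    then obtain f where f: "bij_betw f (pverts T) (pverts S)"
      and E: "\<And>u v. u \<in> pverts T \<Longrightarrow> v \<in> pverts T \<Longrightarrow> (u, v) \<in> parcs T \<longleftrightarrow> (f u, f v) \<in> parcs S"
      unfolding digraph_iso_pair_iff[OF T S] by blast
    have "alternating_order T (q \<circ> f)"
      unfolding alternating_order_def card
      using bij_betw_trans[OF f q'] E qE bij_betwE[OF f] by auto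
    then show "\<exists>p. alternating_order T p" by (rule exI[of _ "q \<circ> f"])
  }
  {
    assume "\<exists>p. alternating_order T p"
    then obtain p where p: "bij_betw p (pverts T) {..<?n}"
      and pE: "\<And>u v. u \<in> pverts T \<Longrightarrow> v \<in> pverts T \<Longrightarrow> (u, v) \<in> parcs T \<longleftrightarrow> alternating_arc (p u) (p v)"
      by (auto simp: alternating_order_def card)
    let ?g = "inv_into (pverts S) q"
    have g: "bij_betw ?g {..<?n} (pverts S)" by (rule bij_betw_inv_into[OF q'])
    have "q (?g (p u)) = p u" "?g (p u) \<in> pverts S" if "u \<in> pverts T" for u
      using bij_betw_inv_into_right[OF q'] bij_betwE[OF p] bij_betwE[OF g] that by auto
    then show "digraph_iso T S"
      unfolding digraph_iso_pair_iff[OF T S] using bij_betw_trans[OF p g] pE qE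
      by (intro exI[of _ "?g \<circ> p"]) auto
  }
qed

lemma swirl_arc_iff:
  assumes "n = 2 * d + 1" "i \<in> {1..n}" "j \<in> {1..n}"
  shows "(i, j) \<in> parcs (swirl n) \<longleftrightarrow> (i < j \<and> j \<le> i + d) \<or> j + n \<le> i + d"
proof -
  have mod: "j mod n = m mod n \<longleftrightarrow> m = j \<or> m = j + n" if "0 < m" "m < 2 * n" for m
  proof (cases "m < n")
    case True
    then show ?thesis using assms that by (cases "j = n") auto
  next
    case False
    then have "m mod n = m - n" using that by (simp add: mod_if)
    then show ?thesis using assms that False by (cases "j = n") auto
  qed
  have "(i, j) \<in> parcs (swirl n) \<longleftrightarrow> (\<exists>k\<in>{1..d}. j mod n = (i + k) mod n)"
    using assms by (auto simp: swirl_def)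
  also have "\<dots> \<longleftrightarrow> (\<exists>k\<in>{1..d}. i + k = j \<or> i + k = j + n)"
    using assms by (intro bex_cong refl mod) auto
  also have "\<dots> \<longleftrightarrow> (i < j \<and> j \<le> i + d) \<or> j + n \<le> i + d"
  proof
    assume "(i < j \<and> j \<le> i + d) \<or> j + n \<le> i + d"
    then show "\<exists>k\<in>{1..d}. i + k = j \<or> i + k = j + n"
    proof
      assume "i < j \<and> j \<le> i + d"
      then show ?thesis by (intro bexI[of _ "j - i"]) auto
    next
      assume "j + n \<le> i + d"
      then show ?thesis using assms by (intro bexI[of _ "j + n - i"]) auto
    qed
  qed auto
  finally show ?thesis .
qed

text \<open>
  Place vertex \<open>i\<close> at the angle \<open>2 \<pi> i / n\<close>, so that arcs go to the vertices within the next half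
  turn. Reflecting the vertices \<open>i > d\<close> through the centre switches them and brings all vertices into one
  half circle, at the angles \<open>2 i\<close> and \<open>2 i - n\<close> in units of \<open>\<pi> / n\<close>. These are distinct numbers in
  \<open>{1..n}\<close> whose parity tells which vertices were reflected. Subtracting them from \<open>n\<close> gives ranks.
\<close>

lemma swirl_alternating_order:
  assumes "n = 2 * d + 1"
  shows "alternating_order (swirl n) (\<lambda>i. if i \<le> d then n - 2 * i else 2 * n - 2 * i)"
    (is "alternating_order _ ?p")
proof -
  have V: "pverts (swirl n) = {1..n}" by (simp add: swirl_def)
  have odd: "odd (?p i) \<longleftrightarrow> i \<le> d" if "i \<in> {1..n}" for i
    using that assms by auto
  have "inj_on ?p {1..n}"
  proof (rule inj_onI)
    fix i j assume ij: "i \<in> {1..n}" "j \<in> {1..n}" "?p i = ?p j"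
    then have "i \<le> d \<longleftrightarrow> j \<le> d" using odd[OF ij(1)] odd[OF ij(2)] by metis
    then show "i = j" using ij assms by (auto split: if_splits)
  qed
  moreover have "?p ` {1..n} \<subseteq> {..<n}" using assms by auto
  ultimately have "bij_betw ?p {1..n} {..<n}"
    unfolding bij_betw_def by (intro conjI card_subset_eq) (simp_all only: card_image, simp_all)
  moreover have "(i, j) \<in> parcs (swirl n) \<longleftrightarrow> alternating_arc (?p i) (?p j)"
    if ij: "i \<in> {1..n}" "j \<in> {1..n}" for i j
  proof -
    have "odd (?p i + ?p j) \<longleftrightarrow> (i \<le> d \<longleftrightarrow> \<not> j \<le> d)"
      using odd[OF ij(1)] odd[OF ij(2)] by (simp only: odd_add) metis
    then show ?thesis
      unfolding swirl_arc_iff[OF assms ij] alternating_arc_def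
      using ij assms by (cases "i \<le> d"; cases "j \<le> d") auto
  qed
  ultimately show ?thesis by (simp only: alternating_order_def V card_atLeastAtMost) simp
qed

section \<open>The minimum number of arborescences\<close>

theorem theorem1p6:
  fixes T :: "'a pair_pre_digraph" and n :: nat
  assumes "tournament T" and "eulerian T"
    and "card (pverts T) = n" and "n \<ge> 1"
  shows "odd n \<and>
    real (arb T) \<ge> 1 / (real n)^2 * (((real n + 1) / 2)^n + ((real n - 1) / 2)^n) \<and>
    (real (arb T) = 1 / (real n)^2 * (((real n + 1) / 2)^n + ((real n - 1) / 2)^n)
       \<longleftrightarrow> digraph_iso T (swirl n))"
proof -
  interpret pair_digraph T using assms(1) by (simp add: tournament_def)
  let ?V = "pverts T" and ?W = "skew_adjacency (parcs T)"
  define D where "D = det_on ?V (\<lambda>i j. (if i = j then real n else 0) + of_int (?W i j))"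
  define B where "B = ((real n + 1) ^ n + (real n - 1) ^ n) / 2"
  have n: "real n > 0" using assms(4) by simp
  obtain r where r: "r \<in> ?V" using assms(3,4) by (metis card.empty ex_in_conv not_one_le_zero)
  define d where "d = out_degree T r"
  have nd: "n = 2 * d + 1"
    using eulerian_tournament_degrees(1)[OF assms(1,2) r] assms(3) by (simp add: d_def)
  have pow: "(2::real) ^ n = 2 * 2 ^ (n - 1)" using nd by simp
  have D: "D = (real n)\<^sup>2 * 2 ^ (n - 1) * real (arb_at T v)" if "v \<in> ?V" for v
    using arb_at_eulerian_tournament[OF assms(1,2) that] unfolding D_def assms(3) by simp
  have same: "arb_at T v = arb_at T r" if "v \<in> ?V" for v
  proof -
    have "(real n)\<^sup>2 * 2 ^ (n - 1) \<noteq> 0" using n by simp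
    then show ?thesis using D[OF that] D[OF r] by (metis mult_cancel_left of_nat_eq_iff)
  qed
  have "arb T = arb_at T r"
    unfolding arb_def
  proof (rule the_equality)
    show "\<forall>v\<in>?V. arb_at T v = arb_at T r" using same by blast
    show "k = arb_at T r" if "\<forall>v\<in>?V. arb_at T v = k" for k using that r by simp
  qed
  then have arb: "real (arb T) = D / ((real n)\<^sup>2 * 2 ^ (n - 1))"
    using n by (simp add: D[OF r])
  have bound: "1 / (real n)^2 * (((real n + 1) / 2)^n + ((real n - 1) / 2)^n) =
      B / ((real n)\<^sup>2 * 2 ^ (n - 1))"
  proof -
    have "1 / N * (a / (2 * P) + b / (2 * P)) = (a + b) / 2 / (N * P)" for N P a b :: real
      by (simp add: add_divide_distrib mult.commute mult.left_commute)
    then show ?thesis unfolding B_def power_divide pow .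
  qed
  note extremal = det_diagonal_plus_skew[where V = ?V and W = ?W, OF pair_finite_verts
      skew_adjacency_skew odd_skew_adjacency[OF assms(1)] n, unfolded assms(3)]
  have "real (arb T) \<ge> 1 / (real n)^2 * (((real n + 1) / 2)^n + ((real n - 1) / 2)^n)"
    unfolding arb bound using extremal(1) n by (intro divide_right_mono) (auto simp: D_def B_def)
  moreover have "real (arb T) = 1 / (real n)^2 * (((real n + 1) / 2)^n + ((real n - 1) / 2)^n)
       \<longleftrightarrow> digraph_iso T (swirl n)"
  proof -
    have "real (arb T) = 1 / (real n)^2 * (((real n + 1) / 2)^n + ((real n - 1) / 2)^n) \<longleftrightarrow> D = B"
      unfolding arb bound using n by simp
    also have "\<dots> \<longleftrightarrow> (\<forall>I\<subseteq>?V. det_on I ?W = of_bool (even (card I)))"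
      unfolding D_def B_def by (rule extremal(2))
    also have "\<dots> \<longleftrightarrow> (\<exists>p. alternating_order T p)"
      using extremal_minors_alternating_order[OF assms(1,2)] alternating_order_minors[OF assms(1)] r
      by blast
    also have "\<dots> \<longleftrightarrow> digraph_iso T (swirl n)"
    proof (rule alternating_order_iso_iff[symmetric])
      show "pair_wf_digraph (swirl n)" by unfold_locales (auto simp: swirl_def)
      show "alternating_order (swirl n) (\<lambda>i. if i \<le> d then n - 2 * i else 2 * n - 2 * i)"
        by (rule swirl_alternating_order[OF nd])
      show "card ?V = card (pverts (swirl n))" by (simp add: assms(3) swirl_def)
    qed (rule pair_wf_digraph_axioms)
    finally show ?thesis .
  qed
  ultimately show ?thesis using nd by simp
qed

end
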